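(* There exists an absolute constant $C>0$ such that for all sufficiently large $n$, \[\left(\frac{5}{6}n-\frac{95}{144}\right)^{1/2}\le f(n,5,6)\le n^{1/2}\,2^{C\sqrt{\log n}\,\log\log n}.\] (Equivalently, as $n\to\infty$, $\left(\frac56 n-\frac{95}{144}\right)^{1/2}\le f(n,5,6)\le n^{1/2}2^{O(\sqrt{\log n}\log\log n)}$.)
   Context: For positive integers $p,q$ with $1\le q\le\binom p2$, a $(p,q)$-coloring of the complete graph $K_n$ is an edge-coloring of $K_n$ in which every copy of $K_p$ contains edges of at least $q$ distinct colors. $f(n,p,q)$ denotes the minimum number of colors in a $(p,q)$-coloring of $K_n$. Logarithms are base $2$. *)

theory Defs
  imports Complex_Main "HOL-Library.Ramsey"
begin

text \<open>
  The complete graph \<open>K_n\<close> has vertex set \<open>{..<n}\<close> and edge set \<open>[{..<n}]\<^bsup>2\<^esup>\<close>, the two-element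
  sets of vertices. A copy of \<open>K_p\<close> in \<open>K_n\<close> is determined by its vertex set.
\<close>

definition pq_coloring :: "nat \<Rightarrow> nat \<Rightarrow> nat \<Rightarrow> (nat set \<Rightarrow> nat) \<Rightarrow> bool" where
  "pq_coloring n p q c \<longleftrightarrow> (\<forall>S \<in> [{..<n}]\<^bsup>p\<^esup>. q \<le> card (c ` [S]\<^bsup>2\<^esup>))"

text \<open>
  Only colors that occur on edges of \<open>K_n\<close> are counted, and the values of \<open>c\<close> elsewhere are
  irrelevant. For \<open>q \<le> p choose 2\<close> an injective edge coloring is a \<open>(p,q)\<close>-coloring, so the
  minimum below is attained; for larger \<open>q\<close> and \<open>p \<le> n\<close> the value carries no meaning.
\<close>

definition min_colors :: "nat \<Rightarrow> nat \<Rightarrow> nat \<Rightarrow> nat" where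
  "min_colors n p q =
     (LEAST k. \<exists>c. pq_coloring n p q c \<and> card (c ` [{..<n}]\<^bsup>2\<^esup>) = k)"

end

theory Submission
  imports Defs "HOL-Computational_Algebra.Primes" "HOL-Library.Countable"
begin

text \<open>
  Lower bound: if \<open>N\<close> is the neighbourhood of a vertex in one colour \<open>i\<close>, every four vertices of
  \<open>N\<close> see at least five colours other than \<open>i\<close>. Hence in \<open>N\<close> colour classes have maximum degree 2,
  and the triangles in which a colour repeats are pairwise edge-disjoint; counting incidences of
  vertices and colours bounds \<open>card N\<close> by about \<open>6/5\<close> of the number of colours.

  Upper bound: vertices are points \<open>(x, y)\<close> over the field with \<open>p\<close> elements, \<open>p\<close> about
  \<open>sqrt n\<close> up to logarithms, and an edge receives the colour \<open>x x' - y - y' mod p\<close>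
  (Mubayi), refined by subpolynomially many colours describing where \<open>x\<close> and \<open>x'\<close> branch in a
  tree of binary digits (Conlon, Fox, Lee and Sudakov). A set of five vertices splits at the top
  branching point into two parts such that no colour occurs both inside a part and between the
  parts; the splits 4+1 and 3+2 with at most five colours are excluded with a few algebraic
  identities and the fact that the two endpoints of a monochromatic path of length two lie on
  the same side of its middle vertex, which therefore is not their midpoint.
\<close>

section \<open>Branching colours\<close>

text \<open>One plus the position of the highest bit in which \<open>a\<close> and \<open>b\<close>
  differ, and 0 if they agree: the height of the lowest common ancestor of the leaves
  \<open>a\<close> and \<open>b\<close> in the binary tree.\<close>

definition top_diff :: "nat \<Rightarrow> nat \<Rightarrow> nat" where
  "top_diff a b = (LEAST k. a div 2 ^ k = b div 2 ^ k)"

text \<open>Once two binary prefixes agree, all shorter ones agree as well. Bounds on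
  \<open>top_diff\<close> thus become equations between prefixes, for which transitivity is
  free.\<close>

lemma top_diff_le_iff: "top_diff a b \<le> k \<longleftrightarrow> a div 2 ^ k = b div 2 ^ k"
proof
  have ex: "\<exists>k. a div 2 ^ k = b div 2 ^ k"
  proof
    have "a < 2 ^ (a + b)" "b < 2 ^ (a + b)"
      using less_exp[of a] less_exp[of b] power_increasing[of a "a + b" "2::nat"]
        power_increasing[of b "a + b" "2::nat"] by linarith+
    then show "a div 2 ^ (a + b) = b div 2 ^ (a + b)" by simp
  qed
  assume le: "top_diff a b \<le> k"
  have "a div 2 ^ top_diff a b = b div 2 ^ top_diff a b"
    unfolding top_diff_def by (rule LeastI_ex[OF ex])
  moreover have "z div 2 ^ k = z div 2 ^ top_diff a b div 2 ^ (k - top_diff a b)" for z :: nat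
    using le by (simp flip: div_mult2_eq power_add)
  ultimately show "a div 2 ^ k = b div 2 ^ k" by simp
qed (simp add: top_diff_def Least_le)

lemma top_diff_commute: "top_diff a b = top_diff b a"
  unfolding top_diff_def by (simp add: eq_commute)

lemma top_diff_eq_0_iff [simp]: "top_diff a b = 0 \<longleftrightarrow> a = b"
  using top_diff_le_iff[of a b 0] by simp

lemma top_diff_self [simp]: "top_diff a a = 0"
  by simp

lemma top_diff_le: "a < 2 ^ t \<Longrightarrow> b < 2 ^ t \<Longrightarrow> top_diff a b \<le> t"
  by (simp add: top_diff_le_iff)

text \<open>A binary tree: two leaves that leave a third one at the same node go the same way there.\<close>

lemma top_diff_binary:
  assumes "top_diff a b = k" "top_diff a c = k" "k > 0"
  shows "top_diff b c < k"
proof -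
  obtain m where m: "k = Suc m" using assms(3) by (cases k) auto
  have half: "z div 2 ^ k = z div 2 ^ m div 2" for z :: nat
    by (simp only: m power_Suc2 div_mult2_eq)
  have "a div 2 ^ k = b div 2 ^ k" "a div 2 ^ k = c div 2 ^ k"
    using assms top_diff_le_iff by (metis order_refl)+
  moreover have "a div 2 ^ m \<noteq> b div 2 ^ m" "a div 2 ^ m \<noteq> c div 2 ^ m"
    using assms m top_diff_le_iff by (metis not_less_eq_eq order_refl)+
  ultimately have "b div 2 ^ m = c div 2 ^ m"
    unfolding half by linarith
  then show ?thesis using top_diff_le_iff[of b c m] m by simp
qed

definition digit :: "nat \<Rightarrow> nat \<Rightarrow> nat \<Rightarrow> nat" where
  "digit t j x = x div 2 ^ (t * j) mod 2 ^ t"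

lemma digit_less: "digit t j x < 2 ^ t"
  by (simp add: digit_def)

text \<open>The prefixes above digit \<open>i\<close> agree because \<open>D <= t * Suc i\<close>.
  If the digit itself agreed too, the prefixes would already agree at \<open>t * i <= D - 1\<close>,
  against the minimality of \<open>D\<close>.\<close>

lemma digit_top_diff_neq:
  assumes "a \<noteq> b" "t > 0"
  shows "digit t ((top_diff a b - 1) div t) a \<noteq> digit t ((top_diff a b - 1) div t) b"
proof
  define D where "D = top_diff a b"
  define i where "i = (D - 1) div t"
  assume "digit t ((top_diff a b - 1) div t) a = digit t ((top_diff a b - 1) div t) b"
  then have "a div 2 ^ (t * i) mod 2 ^ t = b div 2 ^ (t * i) mod 2 ^ t"
    by (simp add: digit_def i_def D_def)
  moreover have D: "D > 0" using assms(1) D_def by (metis gr_zeroI top_diff_eq_0_iff)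
  have "D \<le> t * Suc i"
    using dividend_less_times_div[OF assms(2), of "D - 1"] D unfolding i_def by simp
  then have "a div 2 ^ (t * Suc i) = b div 2 ^ (t * Suc i)"
    using top_diff_le_iff D_def by blast
  then have "a div 2 ^ (t * i) div 2 ^ t = b div 2 ^ (t * i) div 2 ^ t"
    by (simp only: mult_Suc_right add.commute[of t] power_add div_mult2_eq)
  ultimately have "a div 2 ^ (t * i) = b div 2 ^ (t * i)"
    by (metis div_mult_mod_eq)
  then have "D \<le> t * i" using top_diff_le_iff D_def by blast
  moreover have "t * i \<le> D - 1" unfolding i_def by simp
  ultimately show False using D by simp
qed

text \<open>
  \<open>D\<close> locates the most significant bit in which \<open>a\<close> and \<open>b\<close> differ, and \<open>i\<close> the base-\<open>2\<^sup>t\<close> digit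
  containing this bit; for \<open>a = b\<close> the truncated \<open>D - 1\<close> makes \<open>i = 0\<close>. Writing \<open>x\<close> with \<open>t\<close> digits
  of \<open>t\<close> bits each keeps the number of values at \<open>2\<close> to the power of order \<open>t * log t\<close>.
\<close>

definition tree_color :: "nat \<Rightarrow> nat \<Rightarrow> nat \<Rightarrow> nat \<times> nat \<times> nat \<times> nat list" where
  "tree_color t a b =
     (let D = top_diff a b; i = (D - 1) div t
      in (D, min (digit t i a) (digit t i b), max (digit t i a) (digit t i b),
          map (\<lambda>j. top_diff (digit t j a) (digit t j b)) [0..<t]))"

lemma tree_color_commute: "tree_color t a b = tree_color t b a"
  by (simp add: tree_color_def Let_def top_diff_commute min.commute max.commute)

lemma tree_color_top_diff: "tree_color t a b = tree_color t c d \<Longrightarrow> top_diff a b = top_diff c d"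
  by (simp add: tree_color_def Let_def)

lemma tree_color_digit:
  "tree_color t a b = tree_color t c d \<Longrightarrow> j < t \<Longrightarrow>
    top_diff (digit t j a) (digit t j b) = top_diff (digit t j c) (digit t j d)"
  by (simp add: tree_color_def Let_def)

lemma tree_color_pair:
  assumes "tree_color t a b = tree_color t c d" "i = (top_diff a b - 1) div t"
  shows "{digit t i a, digit t i b} = {digit t i c, digit t i d}"
proof -
  have minmax: "{x, y} = {min x y, max x y}" for x y :: nat
    by (auto simp: min_def max_def)
  show ?thesis
    unfolding minmax[of "digit t i a"] minmax[of "digit t i c"]
    using assms(1) tree_color_top_diff[OF assms(1)] unfolding assms(2)
    by (simp add: tree_color_def Let_def)
qed

text \<open>By binary branching \<open>b\<close> and \<open>c\<close> share a prefix that differs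
  from that of \<open>a\<close>. The order of prefixes decides the order of the numbers, so
  \<open>b\<close> and \<open>c\<close> are both larger or both smaller than
  \<open>a\<close>.\<close>

lemma tree_color_midpoint:
  assumes "tree_color t a b = tree_color t a c" "a \<noteq> b"
  shows "b + c \<noteq> 2 * a"
proof -
  define K where "K = top_diff a b"
  have K: "top_diff a b = K" "top_diff a c = K"
    using tree_color_top_diff[OF assms(1)] K_def by simp_all
  have K0: "K > 0" using assms(2) K_def by (metis gr_zeroI top_diff_eq_0_iff)
  then have "top_diff b c \<le> K - 1" using top_diff_binary[OF K K0] by linarith
  then have bc: "b div 2 ^ (K - 1) = c div 2 ^ (K - 1)" using top_diff_le_iff by blast
  have "\<not> top_diff a b \<le> K - 1" using K K0 by linarith
  then have "a div 2 ^ (K - 1) \<noteq> b div 2 ^ (K - 1)" using top_diff_le_iff by blast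
  moreover have mono: "u div 2 ^ (K - 1) < w div 2 ^ (K - 1) \<Longrightarrow> u < w" for u w :: nat
    by (meson div_le_mono leD leI)
  ultimately consider "a div 2 ^ (K - 1) < b div 2 ^ (K - 1)" | "b div 2 ^ (K - 1) < a div 2 ^ (K - 1)"
    by linarith
  then show ?thesis
  proof cases
    case 1
    then have "a < b" "a < c" using mono[of a b] mono[of a c] bc by simp_all
    then show ?thesis by simp
  next
    case 2
    then have "b < a" "c < a" using mono[of b a] mono[of c a] bc by simp_all
    then show ?thesis by simp
  qed
qed

text \<open>
  At the digit where \<open>b\<close> and \<open>c\<close> branch, all endpoints of edges coloured like \<open>b c\<close> lie in a common
  subtree, which \<open>a\<close> has left before because it cannot tell \<open>b\<close> and \<open>c\<close> apart.
\<close>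

lemma tree_color_base:
  assumes lt: "b < 2 ^ (t * t)" "c < 2 ^ (t * t)"
    and ab: "tree_color t a b = tree_color t a c" and "b \<noteq> c"
    and z: "tree_color t b c = tree_color t z z'"
    and f: "tree_color t b c = tree_color t f f'"
    and g: "tree_color t b c = tree_color t g g'"
  shows "tree_color t a z \<noteq> tree_color t f g"
proof
  assume eq: "tree_color t a z = tree_color t f g"
  define i where "i = (top_diff b c - 1) div t"
  let ?d = "digit t i"
  have le: "top_diff b c \<le> t * t" using lt by (rule top_diff_le)
  moreover have pos: "top_diff b c > 0"
    using \<open>b \<noteq> c\<close> by (metis gr_zeroI top_diff_eq_0_iff)
  ultimately have t: "t > 0" by (cases t) simp_all
  have "top_diff b c - 1 < t * t" using pos le by linarith
  then have i: "i < t" unfolding i_def by (simp add: less_mult_imp_div_less)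
  have bc: "?d b \<noteq> ?d c" using digit_top_diff_neq[OF \<open>b \<noteq> c\<close> t] i_def by simp
  define l where "l = top_diff (?d a) (?d b)"
  have l: "top_diff (?d a) (?d b) = l" "top_diff (?d a) (?d c) = l"
    using tree_color_digit[OF ab i] l_def by auto
  \<comment> \<open>The digits of \<open>b\<close> and \<open>c\<close> differ, so the digit of
    \<open>a\<close> cannot equal both of them.\<close>
  have "l > 0" using bc l by (metis gr_zeroI top_diff_eq_0_iff)
  then have small: "top_diff (?d b) (?d c) < l" using top_diff_binary l by blast
  have mem: "?d z \<in> {?d b, ?d c}" "?d f \<in> {?d b, ?d c}" "?d g \<in> {?d b, ?d c}"
    using tree_color_pair[OF z i_def] tree_color_pair[OF f i_def] tree_color_pair[OF g i_def]
    by auto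
  then have "top_diff (?d a) (?d z) = l" using l by auto
  moreover have "top_diff (?d f) (?d g) < l"
    using mem small \<open>l > 0\<close> by (auto simp: top_diff_commute)
  ultimately show False using tree_color_digit[OF eq i] by simp
qed

lemma top_diff_eq_iff: "top_diff a b = top_diff c d \<Longrightarrow> a = b \<longleftrightarrow> c = d"
  using top_diff_eq_0_iff[of a b] top_diff_eq_0_iff[of c d] by simp

lemma doubleton_neq_iff: "a \<noteq> b \<Longrightarrow> {a, b} = {a, c} \<Longrightarrow> {a, b} = {u, w} \<Longrightarrow> (b = w) \<noteq> (c = u)"
  by (auto simp: doubleton_eq_iff)

text \<open>At the digit where \<open>a\<close> and \<open>b\<close> branch, \<open>b\<close> and
  \<open>c\<close> agree, and one of \<open>u\<close>, \<open>w\<close> has the digit of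
  \<open>a\<close>, the other that of \<open>b\<close>. So exactly one of the pairs
  \<open>b w\<close> and \<open>c u\<close> agrees there, whereas equal tree colours would make both
  agree or both differ.\<close>

lemma tree_color_opposite:
  assumes lt: "a < 2 ^ (t * t)" "b < 2 ^ (t * t)" and "a \<noteq> b"
    and ac: "tree_color t a b = tree_color t a c" and uw: "tree_color t a b = tree_color t u w"
  shows "tree_color t b w \<noteq> tree_color t c u"
proof
  assume eq: "tree_color t b w = tree_color t c u"
  define i where "i = (top_diff a b - 1) div t"
  let ?d = "digit t i"
  have le: "top_diff a b \<le> t * t" using lt by (rule top_diff_le)
  moreover have pos: "top_diff a b > 0"
    using \<open>a \<noteq> b\<close> by (metis gr_zeroI top_diff_eq_0_iff)
  ultimately have t: "t > 0" by (cases t) simp_all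
  have "top_diff a b - 1 < t * t" using pos le by linarith
  then have i: "i < t" unfolding i_def by (simp add: less_mult_imp_div_less)
  have "?d a \<noteq> ?d b" using digit_top_diff_neq[OF \<open>a \<noteq> b\<close> t] i_def by simp
  then have "(?d b = ?d w) \<noteq> (?d c = ?d u)"
    by (rule doubleton_neq_iff[OF _ tree_color_pair[OF ac i_def] tree_color_pair[OF uw i_def]])
  moreover have "?d b = ?d w \<longleftrightarrow> ?d c = ?d u"
    using top_diff_eq_iff[OF tree_color_digit[OF eq i]] .
  ultimately show False by (rule notE[of "_ = _"])
qed

section \<open>The construction\<close>

lemma card_less_length_not_distinct:
  "finite T \<Longrightarrow> set xs \<subseteq> T \<Longrightarrow> card T < length xs \<Longrightarrow> \<not> distinct xs"
  by (metis card_mono distinct_card not_less)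

lemma card_le_3_cases:
  assumes "finite T" "card T \<le> 3" "{a, b, c, d} \<subseteq> T"
  shows "a = b \<or> a = c \<or> a = d \<or> b = c \<or> b = d \<or> c = d"
  using card_less_length_not_distinct[of T "[a, b, c, d]"] assms by auto

lemma card_le_2_cases:
  assumes "finite T" "card T \<le> 2" "{a, b, c} \<subseteq> T"
  shows "a = b \<or> a = c \<or> b = c"
  using card_less_length_not_distinct[of T "[a, b, c]"] assms by auto

lemma card_le_4_cases:
  assumes "finite T" "card T \<le> 4" "{a, b, c, d, e} \<subseteq> T"
  shows "a = b \<or> a = c \<or> a = d \<or> a = e \<or> b = c \<or> b = d \<or> b = e \<or> c = d \<or> c = e \<or> d = e"
  using card_less_length_not_distinct[of T "[a, b, c, d, e]"] assms by auto

text \<open>Coordinates stay below \<open>p / 2\<close>, so differences of coordinates, differences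
  of two sums of coordinates, and \<open>X b + X c - 2 * X a\<close> are all smaller than
  \<open>p\<close> in absolute value and vanish once \<open>p\<close> divides them. The first
  coordinates are the leaves of the digit tree.\<close>

locale construction =
  fixes p t :: nat and V :: "'v set" and x y :: "'v \<Rightarrow> nat"
  assumes prime_p: "prime p" and p_gt_2: "2 < p"
    and x_less: "v \<in> V \<Longrightarrow> 2 * x v < p" and y_less: "v \<in> V \<Longrightarrow> 2 * y v < p"
    and x_bits: "v \<in> V \<Longrightarrow> x v < 2 ^ (t * t)"
    and coords_inj: "v \<in> V \<Longrightarrow> w \<in> V \<Longrightarrow> x v = x w \<Longrightarrow> y v = y w \<Longrightarrow> v = w"
begin

abbreviation X where "X v \<equiv> int (x v)"
abbreviation Y where "Y v \<equiv> int (y v)"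

definition col :: "'v \<Rightarrow> 'v \<Rightarrow> int \<times> nat \<times> nat \<times> nat \<times> nat list" where
  "col a b = ((X a * X b - Y a - Y b) mod int p, tree_color t (x a) (x b))"

lemma col_commute: "col a b = col b a"
  by (simp add: col_def tree_color_commute algebra_simps)

lemma col_tree: "col a b = col c d \<Longrightarrow> tree_color t (x a) (x b) = tree_color t (x c) (x d)"
  by (simp add: col_def)

lemma col_dvd:
  "col a b = col c d \<Longrightarrow> int p dvd (X a * X b - Y a - Y b) - (X c * X d - Y c - Y d)"
  by (simp add: col_def mod_eq_dvd_iff)

text \<open>Modulo \<open>p\<close>, the points \<open>b\<close> and \<open>c\<close> lie on a line
  of slope \<open>X a\<close>.\<close>

lemma col_dvd_cherry: "col a b = col a c \<Longrightarrow> int p dvd X a * (X b - X c) - (Y b - Y c)"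
  using col_dvd[of a b a c] by (simp add: algebra_simps)

lemma dvd_less_imp_0: "int p dvd z \<Longrightarrow> \<bar>z\<bar> < int p \<Longrightarrow> z = 0"
  using dvd_imp_le_int[of z "int p"] by linarith

lemma dvd_X: "a \<in> V \<Longrightarrow> b \<in> V \<Longrightarrow> int p dvd X a - X b \<Longrightarrow> x a = x b"
  using dvd_less_imp_0[of "X a - X b"] x_less[of a] x_less[of b] by linarith

lemma dvd_Y: "a \<in> V \<Longrightarrow> b \<in> V \<Longrightarrow> int p dvd Y a - Y b \<Longrightarrow> y a = y b"
  using dvd_less_imp_0[of "Y a - Y b"] y_less[of a] y_less[of b] by linarith

lemma dvd_mult_cancel: "int p dvd z * w \<Longrightarrow> int p dvd z \<or> int p dvd w"
  using prime_p by (simp add: prime_dvd_mult_iff)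

lemma dvd_double: "int p dvd 2 * z \<Longrightarrow> int p dvd z"
  using dvd_mult_cancel[of 2 z] p_gt_2 zdvd_imp_le[of "int p" 2] by auto

section \<open>Cherries: monochromatic paths of length two, with middle, leaves and base\<close>

lemma cherry_x_leaves:
  assumes "b \<in> V" "c \<in> V" "b \<noteq> c" "col a b = col a c"
  shows "x b \<noteq> x c"
proof
  assume eq: "x b = x c"
  then have "int p dvd - (Y b - Y c)" using col_dvd_cherry[OF assms(4)] by simp
  then have "y b = y c" using dvd_Y[OF assms(1,2)] by (simp only: dvd_minus_iff)
  then show False using coords_inj[OF assms(1,2) eq] assms(3) by blast
qed

lemma cherry_x_apex:
  assumes "b \<in> V" "c \<in> V" "b \<noteq> c" "col a b = col a c"
  shows "x a \<noteq> x b" "x a \<noteq> x c"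
proof -
  have "x a = x b \<longleftrightarrow> x a = x c"
    using tree_color_top_diff[OF col_tree[OF assms(4)]] by (metis top_diff_eq_0_iff)
  then show "x a \<noteq> x b" "x a \<noteq> x c" using cherry_x_leaves[OF assms] by auto
qed

text \<open>A midpoint modulo \<open>p\<close> is a true midpoint because the coordinates are small,
  and the tree colour puts both leaves on one side of the middle.\<close>

lemma cherry_midpoint:
  assumes "a \<in> V" "b \<in> V" "c \<in> V" "b \<noteq> c" "col a b = col a c"
  shows "\<not> int p dvd X b + X c - 2 * X a"
proof
  assume "int p dvd X b + X c - 2 * X a"
  then have "X b + X c - 2 * X a = 0"
    using dvd_less_imp_0[of "X b + X c - 2 * X a"] x_less[OF assms(1)] x_less[OF assms(2)] x_less[OF assms(3)]
    by linarith
  then have "x b + x c = 2 * x a" by linarith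
  then show False
    using tree_color_midpoint[OF col_tree[OF assms(5)] cherry_x_apex(1)[OF assms(2-5)]] by simp
qed

text \<open>Both middles give the slope of one line through \<open>b\<close> and \<open>c\<close>,
  and this line is not vertical by \<open>cherry_x_leaves\<close>.\<close>

lemma cherry_same_leaves:
  assumes "{a, z, b, c} \<subseteq> V" "b \<noteq> c" "col a b = col a c" "col z b = col z c"
  shows "x a = x z"
proof -
  have "int p dvd (X a * (X b - X c) - (Y b - Y c)) - (X z * (X b - X c) - (Y b - Y c))"
    by (rule dvd_diff[OF col_dvd_cherry[OF assms(3)] col_dvd_cherry[OF assms(4)]])
  also have "\<dots> = (X a - X z) * (X b - X c)" by (simp add: algebra_simps)
  finally have "int p dvd X a - X z \<or> int p dvd X b - X c" by (rule dvd_mult_cancel)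
  then have "int p dvd X a - X z"
    using dvd_X[of b c] cherry_x_leaves[of b c a] assms(1-3) by auto
  then show ?thesis using dvd_X[of a z] assms(1) by simp
qed

text \<open>Main device for separating colours, inherited from \<open>tree_color_base\<close>. With
  \<open>f = a\<close> and \<open>g = z\<close> it would separate a colour from itself; hence no
  edge at the middle of a cherry has the colour of its base.\<close>

lemma cherry_base:
  assumes "{b, c} \<subseteq> V" "b \<noteq> c" "col a b = col a c"
    and "col b c = col z z'" "col b c = col f f'" "col b c = col g g'"
  shows "col a z \<noteq> col f g"
proof
  have V: "b \<in> V" "c \<in> V" using assms(1) by auto
  assume "col a z = col f g"
  then have "tree_color t (x a) (x z) = tree_color t (x f) (x g)" by (rule col_tree)
  moreover have "tree_color t (x a) (x z) \<noteq> tree_color t (x f) (x g)"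
    by (rule tree_color_base[OF x_bits[OF V(1)] x_bits[OF V(2)] col_tree[OF assms(3)]
          cherry_x_leaves[OF V assms(2,3)] col_tree[OF assms(4)] col_tree[OF assms(5)]
          col_tree[OF assms(6)]])
  ultimately show False by simp
qed

lemma cherry_opposite:
  assumes "{a, b, c} \<subseteq> V" "b \<noteq> c" "col a b = col a c" "col a b = col u w"
  shows "col b w \<noteq> col c u"
proof
  have V: "a \<in> V" "b \<in> V" "c \<in> V" using assms(1) by auto
  assume "col b w = col c u"
  then have "tree_color t (x b) (x w) = tree_color t (x c) (x u)" by (rule col_tree)
  moreover have "tree_color t (x b) (x w) \<noteq> tree_color t (x c) (x u)"
    by (rule tree_color_opposite[OF x_bits[OF V(1)] x_bits[OF V(2)]
          cherry_x_apex(1)[OF V(2,3) assms(2,3)] col_tree[OF assms(3)] col_tree[OF assms(4)]])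
  ultimately show False by simp
qed

text \<open>The two matchings determine twice the slope of \<open>c d\<close> as
  \<open>X a + X b\<close>, the cherry at \<open>v\<close> determines the slope as
  \<open>X v\<close>; in the combination below all \<open>Y\<close> terms cancel.\<close>

lemma two_matchings_midpoint:
  assumes "{v, a, b, c, d} \<subseteq> V" "c \<noteq> d"
    and vcd: "col v c = col v d" and ac: "col a c = col b d" and ad: "col a d = col b c"
  shows "int p dvd X a + X b - 2 * X v"
proof -
  have "int p dvd ((X a * X c - Y a - Y c) - (X b * X d - Y b - Y d))
      - ((X a * X d - Y a - Y d) - (X b * X c - Y b - Y c))
      - 2 * (X v * (X c - X d) - (Y c - Y d))"
    by (rule dvd_diff[OF dvd_diff[OF col_dvd[OF ac] col_dvd[OF ad]]
          dvd_mult[OF col_dvd_cherry[OF vcd]]])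
  also have "\<dots> = (X a + X b - 2 * X v) * (X c - X d)" by (simp add: algebra_simps)
  finally have "int p dvd X a + X b - 2 * X v \<or> int p dvd X c - X d" by (rule dvd_mult_cancel)
  then show ?thesis using dvd_X[of c d] cherry_x_leaves[of c d v] assms(1,2) vcd by auto
qed

text \<open>The cherry over \<open>c d\<close> makes \<open>v\<close> the midpoint of
  \<open>a\<close> and \<open>b\<close>, which the cherry over \<open>a b\<close> forbids.\<close>

lemma star_2_2:
  assumes "{v, a, b, c, d} \<subseteq> V" "a \<noteq> b" "c \<noteq> d" "col v a = col v b" "col v c = col v d"
    and "col a c = col b d" "col a d = col b c"
  shows False
  using two_matchings_midpoint[of v a b c d] cherry_midpoint[of v a b] assms by simp

text \<open>Two choices of a cherry at \<open>v\<close> make \<open>v\<close> the midpoint both of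
  \<open>a\<close>, \<open>d\<close> and of \<open>b\<close>, \<open>d\<close>, so \<open>a\<close>
  and \<open>b\<close> lie in one column although they are leaves of a cherry.\<close>

lemma star_3_1:
  assumes "{v, a, b, c, d} \<subseteq> V" "distinct [a, b, c, d]" "col v a = col v b" "col v b = col v c"
    and "col a b = col c d" "col a c = col b d" "col a d = col b c"
  shows False
proof -
  have "int p dvd X a + X d - 2 * X v"
    using two_matchings_midpoint[of v a d b c] assms by (simp add: col_commute)
  moreover have "int p dvd X b + X d - 2 * X v"
    using two_matchings_midpoint[of v b d a c] assms by (simp add: col_commute)
  ultimately have "int p dvd (X a + X d - 2 * X v) - (X b + X d - 2 * X v)" by (rule dvd_diff)
  then have "x a = x b" using dvd_X[of a b] assms(1) by simp
  then show False using cherry_x_leaves[of a b v] assms by simp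
qed

text \<open>For equal \<open>x\<close> the products cancel and \<open>2 * (Y u - Y w)\<close> is
  left; \<open>p\<close> is odd.\<close>

lemma vertical_two_matchings:
  assumes "{u, w} \<subseteq> V" "x u = x w" "col u b = col w c" "col w b = col u c"
  shows "u = w"
proof -
  have "int p dvd ((X w * X b - Y w - Y b) - (X u * X c - Y u - Y c))
    - ((X u * X b - Y u - Y b) - (X w * X c - Y w - Y c))"
    by (rule dvd_diff[OF col_dvd[OF assms(4)] col_dvd[OF assms(3)]])
  also have "\<dots> = 2 * (Y u - Y w)" using assms(2) by simp
  finally have "y u = y w" using dvd_double[of "Y u - Y w"] dvd_Y[of u w] assms(1) by simp
  then show ?thesis using coords_inj[of u w] assms(1,2) by simp
qed

text \<open>Cut at the topmost branching level \<open>K\<close> occurring in \<open>S\<close>.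
  Crossing edges have level \<open>K\<close>, inner edges a smaller one, and the level is part of
  the colour.\<close>

lemma tree_split:
  assumes "finite S" "S \<subseteq> V" "v \<in> S" "w \<in> S" "x v \<noteq> x w"
  obtains A B where "S = A \<union> B" "A \<inter> B = {}" "A \<noteq> {}" "B \<noteq> {}"
    "\<And>a b. a \<in> A \<Longrightarrow> b \<in> B \<Longrightarrow> x a \<noteq> x b"
    "\<And>a b c d. a \<in> A \<Longrightarrow> b \<in> B \<Longrightarrow> {c, d} \<subseteq> A \<or> {c, d} \<subseteq> B \<Longrightarrow> col a b \<noteq> col c d"
proof -
  define D where "D = (\<lambda>(a, b). top_diff (x a) (x b)) ` (S \<times> S)"
  define K where "K = Max D"
  have fin: "finite D" using assms(1) D_def by simp
  have le: "top_diff (x a) (x b) \<le> K" if "a \<in> S" "b \<in> S" for a b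
    unfolding K_def by (rule Max_ge[OF fin]) (use that D_def in auto)
  have "D \<noteq> {}" using assms(3) D_def by auto
  then have "K \<in> D" unfolding K_def using fin by (rule Max_in[rotated])
  then obtain r s where rs: "r \<in> S" "s \<in> S" "top_diff (x r) (x s) = K" using D_def by auto
  have "top_diff (x v) (x w) \<noteq> 0" using assms(5) by simp
  then have K: "K > 0" using le[OF assms(3,4)] by linarith
  define A where "A = {a \<in> S. top_diff (x r) (x a) < K}"
  define B where "B = {b \<in> S. top_diff (x r) (x b) = K}"
  have inB: "top_diff (x c) (x d) < K" if "c \<in> B" "d \<in> B" for c d
    using that K top_diff_binary[of "x r" "x c" K "x d"] unfolding B_def by simp
  \<comment> \<open>Having level below \<open>K\<close> means having equal prefixes, so it is an
    equivalence relation; binary branching leaves just the two classes \<open>A\<close> and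
    \<open>B\<close>.\<close>
  have div: "z div 2 ^ (K - 1) = z' div 2 ^ (K - 1) \<longleftrightarrow> top_diff z z' < K" for z z'
    using K top_diff_le_iff[of z z' "K - 1"] by linarith
  have inA: "top_diff (x c) (x d) < K" if "c \<in> A" "d \<in> A" for c d
    using that unfolding A_def div[symmetric] by simp
  have AB: "top_diff (x a) (x b) = K" if "a \<in> A" "b \<in> B" for a b
  proof -
    have ra: "top_diff (x r) (x a) < K" and rb: "top_diff (x r) (x b) = K"
      using that unfolding A_def B_def by auto
    have "\<not> top_diff (x a) (x b) < K"
      using div[of "x r" "x a"] div[of "x a" "x b"] div[of "x r" "x b"] ra rb by simp
    then show ?thesis using le that A_def B_def by fastforce
  qed
  show thesis
  proof (rule that[of A B])
    show "S = A \<union> B" using le[OF rs(1)] unfolding A_def B_def by (auto simp: le_neq_implies_less)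
    show "A \<inter> B = {}" unfolding A_def B_def by auto
    show "A \<noteq> {}" using rs(1) K unfolding A_def by auto
    show "B \<noteq> {}" using rs unfolding B_def by auto
    show "x a \<noteq> x b" if "a \<in> A" "b \<in> B" for a b using AB[OF that] K by auto
    show "col a b \<noteq> col c d" if "a \<in> A" "b \<in> B" "{c, d} \<subseteq> A \<or> {c, d} \<subseteq> B" for a b c d
      using AB[OF that(1,2)] inA[of c d] inB[of c d] that(3)
        tree_color_top_diff[OF col_tree[of a b c d]] by auto
  qed
qed

section \<open>Four vertices with at most three colours\<close>

text \<open>Otherwise \<open>b\<close>, \<open>c\<close>, \<open>d\<close> are all endpoints of
  edges coloured like the base, and \<open>cherry_base\<close> separates so many colours that
  \<open>a d\<close> must take the colour of \<open>a c\<close>. Then \<open>a\<close> and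
  \<open>b\<close> are both middles over \<open>c\<close> and \<open>d\<close>, hence in one
  column.\<close>

lemma k4_cherry_base_neq:
  assumes "{a, b, c, d} \<subseteq> V" "distinct [a, b, c, d]" "finite T" "card T \<le> 3"
    and T: "{col a b, col a c, col a d, col b c, col b d, col c d} \<subseteq> T"
    and "col a b = col a c"
  shows "col b d \<noteq> col b c"
proof
  assume bd: "col b d = col b c"
  have "col a b \<noteq> col b c"
    by (rule cherry_base[of b c a b c b c c b]) (use assms(1,2,6) in \<open>auto simp: col_commute\<close>)
  moreover have "col a b \<noteq> col c d"
    by (rule cherry_base[of b c a b c c b d b]) (use assms(1,2,6) bd in \<open>auto simp: col_commute\<close>)
  moreover have "col b c \<noteq> col c d"
    by (rule cherry_base[of c d b c d c d d c]) (use assms(1,2,6) bd in \<open>auto simp: col_commute\<close>)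
  moreover have "col a d \<noteq> col b c"
    by (rule cherry_base[of b c a d b b c c b]) (use assms(1,2,6) bd in \<open>auto simp: col_commute\<close>)
  moreover have "col a d \<noteq> col c d"
    by (rule cherry_base[of b c a d b c b d b]) (use assms(1,2,6) bd in \<open>auto simp: col_commute\<close>)
  moreover have "\<not> distinct [col a b, col b c, col c d, col a d]"
    by (rule card_less_length_not_distinct[OF assms(3)]) (use assms(4) T in simp_all)
  ultimately have "col a d = col a c" using assms(6) by auto
  then have "x a = x b"
    using cherry_same_leaves[of a b c d] assms(1,2) bd by simp
  then show False using cherry_x_apex(1)[of b c a] assms(1,2,6) by simp
qed

text \<open>With three colours \<open>a d\<close> must share its colour with \<open>c d\<close>. So
  \<open>c\<close> is an endpoint of an edge coloured like the base \<open>a d\<close> of the cherry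
  at \<open>b\<close>, and \<open>cherry_base\<close> separates \<open>b a\<close> from
  \<open>a c\<close>.\<close>

lemma k4_no_second_cherry:
  assumes "{a, b, c, d} \<subseteq> V" "distinct [a, b, c, d]" "finite T" "card T \<le> 3"
    and T: "{col a b, col a c, col a d, col b c, col b d, col c d} \<subseteq> T"
    and "col a b = col a c" "col b d = col a b" "col c d \<noteq> col a b" "col c d \<noteq> col b c"
    "col a d \<noteq> col b c"
  shows False
proof -
  have "col a b \<noteq> col b c"
    by (rule cherry_base[of b c a b c b c c b]) (use assms(1,2,6) in \<open>auto simp: col_commute\<close>)
  moreover have "col b a \<noteq> col a d"
    by (rule cherry_base[of a d b a d a d d a]) (use assms(1,2,7) in \<open>auto simp: col_commute\<close>)
  moreover have "\<not> distinct [col a b, col b c, col c d, col a d]"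
    by (rule card_less_length_not_distinct[OF assms(3)]) (use assms(4) T in simp_all)
  ultimately have ad: "col a d = col c d"
    using assms(8-10) col_commute[of a b] by auto
  have "col b a \<noteq> col a c"
    by (rule cherry_base[of a d b a d a d c d])
      (use assms(1,2,7) ad in \<open>auto simp: col_commute\<close>)
  then show False using assms(6) col_commute[of a b] by simp
qed

text \<open>Both edges from \<open>d\<close> to the leaves avoid the base colour, and so does
  \<open>a d\<close>. If they agree, \<open>d\<close> is a second middle; if not, one of them
  continues the cherry and \<open>k4_no_second_cherry\<close> applies.\<close>

lemma k4_no_cherry:
  assumes "{a, b, c, d} \<subseteq> V" "distinct [a, b, c, d]" "finite T" "card T \<le> 3"
    and T: "{col a b, col a c, col a d, col b c, col b d, col c d} \<subseteq> T"
  shows "col a b \<noteq> col a c"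
proof
  assume abc: "col a b = col a c"
  have V: "a \<in> V" "b \<in> V" "c \<in> V" "d \<in> V" using assms(1) by auto
  have ne: "a \<noteq> b" "a \<noteq> c" "a \<noteq> d" "b \<noteq> c" "b \<noteq> d" "c \<noteq> d" using assms(2) by auto
  have cb: "col c b = col b c" by (rule col_commute)
  have T': "{col a c, col a b, col a d, col c b, col c d, col b d} \<subseteq> T"
    using T unfolding cb by blast
  have V': "{a, c, b, d} \<subseteq> V" "distinct [a, c, b, d]" using V ne by auto
  have bd: "col b d \<noteq> col b c"
    by (rule k4_cherry_base_neq[OF assms abc])
  have cd: "col c d \<noteq> col b c"
    using k4_cherry_base_neq[OF V' assms(3,4) T' abc[symmetric]] unfolding cb .
  have bc: "col a b \<noteq> col b c"
    by (rule cherry_base[of b c a b c b c c b]) (use V ne abc cb in auto)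
  have ad: "col a d \<noteq> col b c"
  proof
    assume ad: "col a d = col b c"
    \<comment> \<open>Otherwise the middle \<open>a\<close> is itself an endpoint of an edge
      coloured like the base.\<close>
    have "col a b \<noteq> col a b"
      by (rule cherry_base[of b c a b c a d b c]) (use V ne abc ad in auto)
    then show False by simp
  qed
  have xa: "x a \<noteq> x b" "x b \<noteq> x c"
    using cherry_x_apex(1)[OF V(2,3) ne(4) abc] cherry_x_leaves[OF V(2,3) ne(4) abc] .
  show False
  proof (cases "col b d = col c d")
    case True
    then have dbc: "col d b = col d c" by (simp add: col_commute[of d])
    \<comment> \<open>Now \<open>a\<close> and \<open>d\<close> share a column. Either
      \<open>b\<close> and \<open>c\<close> are both middles over \<open>a\<close> and
      \<open>d\<close>, or the pigeonhole yields a cherry with leg \<open>a d\<close>, whose ends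
      would lie in different columns.\<close>
    have xad: "x a = x d" by (rule cherry_same_leaves[OF _ ne(4) abc dbc]) (use V in auto)
    show False
    proof (cases "col b d = col a b")
      case bd: True
      have "col b a = col b d" "col c a = col c d"
        using bd True abc col_commute[of a b] col_commute[of a c] by metis+
      then have "x b = x c"
        by (rule cherry_same_leaves[OF _ ne(3), rotated]) (use V in auto)
      then show False using xa(2) by blast
    next
      case False
      have "col b c = col a b \<or> col b c = col b d \<or> col b c = col a d \<or> col a b = col b d
          \<or> col a b = col a d \<or> col b d = col a d"
        by (rule card_le_3_cases[OF assms(3,4)]) (use T in blast)
      then consider "col a b = col a d" | "col d a = col d b"
        using False bc bd ad col_commute by metis
      then show False
      proof cases
        case 1
        then show False using cherry_x_apex(2)[OF V(2,4) ne(5)] xad by blast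
      next
        case 2
        then show False using cherry_x_apex(1)[OF V(1,2) ne(1)] xad by metis
      qed
    qed
  next
    case False
    have "col b c = col a b \<or> col b c = col b d \<or> col b c = col c d \<or> col a b = col b d
        \<or> col a b = col c d \<or> col b d = col c d"
      by (rule card_le_3_cases[OF assms(3,4)]) (use T in blast)
    then consider "col b d = col a b" | "col c d = col a c" using False bc bd cd abc by metis
    then show False
    proof cases
      case 1
      show False
        by (rule k4_no_second_cherry[OF assms abc 1 _ cd ad]) (use False 1 in metis)
    next
      case 2
      show False
        by (rule k4_no_second_cherry[OF V' assms(3,4) T' abc[symmetric] 2]) (use False 2 bd ad cb in metis)+
    qed
  qed
qed

text \<open>Without cherries the colouring is proper, and three colours on the six edges leave only
  the three perfect matchings as colour classes.\<close>

lemma k4_matchings: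
  assumes "{a, b, c, d} \<subseteq> V" "distinct [a, b, c, d]" "finite T" "card T \<le> 3"
    and T: "{col a b, col a c, col a d, col b c, col b d, col c d} \<subseteq> T"
  shows "col a b = col c d" "col a c = col b d" "col a d = col b c"
    "distinct [col a b, col a c, col a d]"
proof -
  have no: "col u v \<noteq> col u w"
    if "{u, v, w, z} = {a, b, c, d}" "distinct [u, v, w, z]" for u v w z
  proof (rule k4_no_cherry[of u v w z T])
    have "u \<in> {a, b, c, d}" "v \<in> {a, b, c, d}" "w \<in> {a, b, c, d}" "z \<in> {a, b, c, d}"
      using that(1) by blast+
    moreover have "col r s \<in> T" if "r \<in> {a, b, c, d}" "s \<in> {a, b, c, d}" "r \<noteq> s" for r s
      using that T col_commute by (metis insert_iff insert_subset singletonD)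
    ultimately show "{col u v, col u w, col u z, col v w, col v z, col w z} \<subseteq> T"
      using that(2) by simp
  qed (use that assms in auto)
  have "distinct [a, b, c, d]" by fact
  then have n: "col a b \<noteq> col a c" "col a b \<noteq> col a d" "col a c \<noteq> col a d"
    "col b a \<noteq> col b c" "col b a \<noteq> col b d" "col b c \<noteq> col b d"
    "col c a \<noteq> col c b" "col c a \<noteq> col c d" "col c b \<noteq> col c d"
    "col d a \<noteq> col d b" "col d a \<noteq> col d c" "col d b \<noteq> col d c"
    using no[of a b c d] no[of a b d c] no[of a c d b] no[of b a c d] no[of b a d c] no[of b c d a]
      no[of c a b d] no[of c a d b] no[of c b d a] no[of d a b c] no[of d a c b] no[of d b c a]
    by auto
  have pig: "z = col a b \<or> z = col a c \<or> z = col a d" if "z \<in> T" for z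
    using card_le_3_cases[OF assms(3,4), of z "col a b" "col a c" "col a d"] that T n(1-3) by simp
  have "col c d \<in> T" "col b d \<in> T" "col b c \<in> T" using T by auto
  note pig[OF this(1)] pig[OF this(2)] pig[OF this(3)]
  then show "col a b = col c d" "col a c = col b d" "col a d = col b c"
    using n col_commute by metis+
  show "distinct [col a b, col a c, col a d]" using n(1-3) by simp
qed

section \<open>Splits of type four plus one\<close>

lemma two_colors_cases:
  assumes "finite T" "card T \<le> 2" "{a, b, c, d} \<subseteq> T"
  shows "a = b \<and> c = d \<or> a = c \<and> b = d \<or> a = d \<and> b = c \<or>
    a = b \<and> b = c \<or> a = b \<and> b = d \<or> a = c \<and> c = d \<or> b = c \<and> c = d"
proof -
  have "a = b \<or> a = c \<or> b = c" "a = b \<or> a = d \<or> b = d"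
    "a = c \<or> a = d \<or> c = d" "b = c \<or> b = d \<or> c = d"
    by (rule card_le_2_cases[OF assms(1,2)]; use assms(3) in blast)+
  then show ?thesis by argo
qed

text \<open>If the four vertices see three colours, these form matchings, and the at most two star
  colours are distributed 2+2 or with three equal, as in \<open>star_2_2\<close> and
  \<open>star_3_1\<close>. Otherwise the star is monochromatic and at most four colours are left
  inside.\<close>

lemma no_star:
  assumes V: "{v, a, b, c, d} \<subseteq> V" and dist: "distinct [v, a, b, c, d]"
    and fin: "finite R" "finite T" and card: "card R + card T \<le> 5"
    and R: "{col v a, col v b, col v c, col v d} \<subseteq> R"
    and T: "{col a b, col a c, col a d, col b c, col b d, col c d} \<subseteq> T"
  shows False
proof -
  have Vs: "v \<in> V" "a \<in> V" "b \<in> V" "c \<in> V" "d \<in> V" using V by auto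
  have ne: "a \<noteq> b" "a \<noteq> c" "a \<noteq> d" "b \<noteq> c" "b \<noteq> d" "c \<noteq> d" using dist by auto
  have V4: "{a, b, c, d} \<subseteq> V" "distinct [a, b, c, d]" using V dist by auto
  have V': "{v, a, c, b, d} \<subseteq> V" "{v, a, d, b, c} \<subseteq> V" "{v, a, b, d, c} \<subseteq> V"
    "{v, a, c, d, b} \<subseteq> V" "{v, b, c, d, a} \<subseteq> V"
    using Vs by simp_all
  have dist': "distinct [a, b, d, c]" "distinct [a, c, d, b]" "distinct [b, c, d, a]"
    using dist by auto
  note com = col_commute[of b a] col_commute[of c a] col_commute[of d a]
    col_commute[of c b] col_commute[of d b] col_commute[of d c]
  have ab: "\<not> (col v a = col v b \<and> col v c = col v d \<and> col a c = col b d \<and> col a d = col b c)"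
    using star_2_2[OF V ne(1) ne(6)] by blast
  have ac: "\<not> (col v a = col v c \<and> col v b = col v d \<and> col a b = col c d \<and> col a d = col b c)"
    using star_2_2[OF V'(1) ne(2) ne(5)] com(4) by metis
  have ad: "\<not> (col v a = col v d \<and> col v b = col v c \<and> col a b = col c d \<and> col a c = col b d)"
    using star_2_2[OF V'(2) ne(3) ne(4)] com(5,6) by metis
  show False
  proof (cases "card T \<le> 3")
    case True
    note m = k4_matchings[OF V4 fin(2) True T]
    have "card {col a b, col a c, col a d} \<le> card T" by (rule card_mono[OF fin(2)]) (use T in auto)
    then have "card R \<le> 2" using m(4) card by simp
    note two_colors_cases[OF fin(1) this R]
    moreover have "\<not> (col v a = col v b \<and> col v b = col v c)"
      using star_3_1[OF V V4(2)] m(1-3) by metis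
    moreover have "\<not> (col v a = col v b \<and> col v b = col v d)"
      using star_3_1[OF V'(3) dist'(1)] m(1-3) com by metis
    moreover have "\<not> (col v a = col v c \<and> col v c = col v d)"
      using star_3_1[OF V'(4) dist'(2)] m(1-3) com by metis
    moreover have "\<not> (col v b = col v c \<and> col v c = col v d)"
      using star_3_1[OF V'(5) dist'(3)] m(1-3) com by metis
    ultimately show False using ab ac ad m(1-3) by argo
  next
    case False
    then have "card R \<le> 1" using card by simp
    then have eq: "z = w" if "z \<in> R" "w \<in> R" for z w
      using that fin(1) card_le_Suc0_iff_eq by auto
    have va: "col v a = col v b" "col v a = col v c" "col v a = col v d"
      by (rule eq; use R in blast)+
    have "card R \<noteq> 0" using R fin(1) by auto
    then have T4: "card T \<le> 4" using card by simp
    \<comment> \<open>A cherry inside would have its middle in the column of \<open>v\<close>, which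
      is a second middle over the same leaves; but \<open>v\<close> is also joined to that middle by
      a leg of a cherry.\<close>
    have no: "col r s \<noteq> col r u"
      if "r \<in> {a, b, c, d}" "s \<in> {a, b, c, d}" "u \<in> {a, b, c, d}" "s \<noteq> u" for r s u
    proof
      assume rsu: "col r s = col r u"
      have in_V: "r \<in> V" "s \<in> V" "u \<in> V" using that Vs by auto
      have all: "col v z = col v a" if "z \<in> {a, b, c, d}" for z using that va by auto
      have su: "col v s = col v u" using all[OF that(2)] all[OF that(3)] by simp
      have "x r = x v"
        by (rule cherry_same_leaves[OF _ that(4) rsu su]) (use in_V Vs in simp)
      moreover obtain z where z: "z \<in> {a, b, c, d}" "z \<noteq> r" using ne by auto
      have rz: "col v r = col v z" using all[OF that(1)] all[OF z(1)] by simp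
      have "z \<in> V" using z(1) Vs by auto
      then have "x v \<noteq> x r" using cherry_x_apex(1)[OF in_V(1) _ z(2)[symmetric] rz] by simp
      ultimately show False by simp
    qed
    have n: "col a b \<noteq> col a c" "col a b \<noteq> col a d" "col a c \<noteq> col a d"
      "col b a \<noteq> col b c" "col b a \<noteq> col b d" "col b c \<noteq> col b d"
      "col c a \<noteq> col c b" "col c a \<noteq> col c d" "col c b \<noteq> col c d"
      "col d a \<noteq> col d b" "col d a \<noteq> col d c" "col d b \<noteq> col d c"
      by (rule no; use ne in simp)+
    \<comment> \<open>Proper with at most four colours: omitting one edge leaves five, of which two
      opposite ones agree. So at least two of the three opposite pairs agree.\<close>
    note pig = card_le_4_cases[OF fin(2) T4]
    have "col a c = col b d \<or> col a d = col b c"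
      using pig[of "col a b" "col a c" "col a d" "col b c" "col b d"] T n[unfolded com] by blast
    moreover have "col a b = col c d \<or> col a d = col b c"
      using pig[of "col a b" "col a c" "col a d" "col b c" "col c d"] T n[unfolded com] by blast
    moreover have "col a b = col c d \<or> col a c = col b d"
      using pig[of "col a b" "col a c" "col a d" "col b d" "col c d"] T n[unfolded com] by blast
    ultimately show False using ab ac ad va by metis
  qed
qed

section \<open>Splits of type three plus two\<close>

text \<open>Neither \<open>u\<close> nor \<open>w\<close> is a middle over \<open>b\<close> and
  \<open>c\<close>, being in another column than \<open>a\<close>. The cases are whether
  \<open>u w\<close> repeats the colour of the legs, that of the base, or neither.\<close>

lemma no_3_2_cherry:
  assumes V: "{a, b, c, u, w} \<subseteq> V" and dist: "distinct [a, b, c, u, w]"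
    and x: "x a \<noteq> x u" "x a \<noteq> x w"
    and fin: "finite R" "finite T" and card: "card R + card T \<le> 5"
    and R: "{col a u, col b u, col c u, col a w, col b w, col c w} \<subseteq> R"
    and T: "{col a b, col a c, col b c, col u w} \<subseteq> T"
    and abc: "col a b = col a c"
  shows False
proof -
  have Vs: "a \<in> V" "b \<in> V" "c \<in> V" "u \<in> V" "w \<in> V" using V by auto
  have bc: "b \<noteq> c" and uw: "u \<noteq> w" using dist by auto
  have V2: "{b, c} \<subseteq> V" "{u, w} \<subseteq> V" and V3: "{a, b, c} \<subseteq> V" using Vs by auto
  have n_ab: "col a b \<noteq> col b c"
    by (rule cherry_base[OF V2(1) bc abc refl refl col_commute])
  have leaf: "col b z \<noteq> col c z" if "z \<in> V" "x a \<noteq> x z" for z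
  proof
    assume "col b z = col c z"
    then have "col z b = col z c" by (simp only: col_commute[of z])
    then show False using cherry_same_leaves[OF _ bc abc, of z] that Vs by simp
  qed
  have bcu: "col b u \<noteq> col c u" and bcw: "col b w \<noteq> col c w"
    using leaf x Vs by blast+
  have T2: "2 \<le> card T"
    using card_mono[OF fin(2), of "{col a b, col b c}"] T n_ab by simp
  then have R3: "card R \<le> 3" using card by simp
  note com = col_commute[of u] col_commute[of w]
  have com_uw: "col u w = col w u" by (rule col_commute)
  show False
  proof (cases "col u w = col a b \<or> col u w = col b c")
    case True
    then consider "col u w = col a b" | "col u w = col b c" by blast
    then show False
    proof cases
      case 1
      \<comment> \<open>\<open>b\<close> and \<open>c\<close> are endpoints of edges coloured like
        \<open>u w\<close>, so they are not middles over it, and \<open>cherry_opposite\<close>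
        separates the diagonals. The four crossing edges at \<open>b\<close> and \<open>c\<close>
        get four colours, too many for \<open>R\<close>.\<close>
      have "col b u \<noteq> col b w"
      proof
        assume "col b u = col b w"
        from cherry_base[OF V2(2) uw this refl 1[unfolded col_commute[of a b]] refl]
        show False by simp
      qed
      moreover have "col c u \<noteq> col c w"
      proof
        assume "col c u = col c w"
        from cherry_base[OF V2(2) uw this refl 1[unfolded abc col_commute[of a c]] refl]
        show False by simp
      qed
      moreover have "col b w \<noteq> col c u"
        by (rule cherry_opposite[OF V3 bc abc 1[symmetric]])
      moreover have "col b u \<noteq> col c w"
        by (rule cherry_opposite[OF V3 bc abc 1[symmetric, unfolded com_uw]])
      moreover have "col b u = col b w \<or> col b u = col c u \<or> col b u = col c w \<or>
          col b w = col c u \<or> col b w = col c w \<or> col c u = col c w"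
        by (rule card_le_3_cases[OF fin(1) R3]) (use R in blast)
      ultimately show False using bcu bcw by argo
    next
      case 2
      have bu: "col b u \<noteq> col b w"
      proof
        assume "col b u = col b w"
        from cherry_base[OF V2(2) uw this refl 2 refl] show False by simp
      qed
      have cu: "col c u \<noteq> col c w"
      proof
        assume "col c u = col c w"
        from cherry_base[OF V2(2) uw this refl 2[unfolded col_commute[of b c]] refl]
        show False by simp
      qed
      \<comment> \<open>All of \<open>b\<close>, \<open>c\<close>, \<open>u\<close>,
        \<open>w\<close> are endpoints of edges in the base colour, so the colours at
        \<open>a\<close> do not occur between \<open>b\<close>, \<open>c\<close> and
        \<open>u\<close>, \<open>w\<close>. Of the three colours in \<open>R\<close> one goes to
        \<open>a\<close> and two form matchings.\<close>
      have base: "col a z \<noteq> col f g"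
        if "z \<in> {u, w}" "f \<in> {b, c}" "g \<in> {u, w}" for z f g
      proof -
        have ends: "\<exists>z'. col b c = col z z'" if "z \<in> {b, c, u, w}" for z
          using that 2 col_commute by (metis empty_iff insert_iff)
        have "z \<in> {b, c, u, w}" "f \<in> {b, c, u, w}" "g \<in> {b, c, u, w}" using that by auto
        then obtain z' f' g' where "col b c = col z z'" "col b c = col f f'" "col b c = col g g'"
          using ends by meson
        then show ?thesis by (rule cherry_base[OF V2(1) bc abc])
      qed
      have "col b u = col c w"
      proof (rule ccontr)
        assume "col b u \<noteq> col c w"
        moreover have "col b u = col b w \<or> col b u = col c w \<or> col b u = col a u \<or>
            col b w = col c w \<or> col b w = col a u \<or> col c w = col a u"
          by (rule card_le_3_cases[OF fin(1) R3]) (use R in blast)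
        ultimately show False
          using bu bcw base[of u b u] base[of u b w] base[of u c w] by auto
      qed
      moreover have "col b w = col c u"
      proof (rule ccontr)
        assume "col b w \<noteq> col c u"
        moreover have "col b w = col b u \<or> col b w = col c u \<or> col b w = col a u \<or>
            col b u = col c u \<or> col b u = col a u \<or> col c u = col a u"
          by (rule card_le_3_cases[OF fin(1) R3]) (use R in blast)
        ultimately show False
          using bu bcu base[of u b u] base[of u b w] base[of u c u] by auto
      qed
      moreover have "col a u = col a w"
      proof (rule ccontr)
        assume "col a u \<noteq> col a w"
        moreover have "col b w = col b u \<or> col b w = col a w \<or> col b w = col a u \<or>
            col b u = col a w \<or> col b u = col a u \<or> col a w = col a u"
          by (rule card_le_3_cases[OF fin(1) R3]) (use R in blast)
        ultimately show False
          using bu base[of u b u] base[of u b w] base[of w b u] base[of w b w] by auto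
      qed
      ultimately show False using star_2_2[OF V bc uw abc] by blast
    qed
  next
    case False
    \<comment> \<open>A third inner colour leaves two for \<open>R\<close>. The colours at
      \<open>b\<close> and \<open>c\<close> are then either constant or swapped between
      \<open>u\<close> and \<open>w\<close>.\<close>
    have "card {col a b, col b c, col u w} \<le> card T"
      by (rule card_mono[OF fin(2)]) (use T in auto)
    then have "card R \<le> 2" using n_ab False card by auto
    note two = card_le_2_cases[OF fin(1) this]
    have bcu': "z = col b u \<or> z = col c u" if "z \<in> R" for z
      using two[of z "col b u" "col c u"] that R bcu by blast
    have Rs: "col a u \<in> R" "col b w \<in> R" "col c w \<in> R" "col a w \<in> R" using R by auto
    show False
    proof (cases "col b w = col b u")
      case True
      then have "col c w = col c u" using bcu'[OF Rs(3)] bcw by argo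
      from cherry_same_leaves[OF _ uw True[symmetric] this[symmetric]]
      have "x b = x c" using Vs by simp
      then show False using cherry_x_leaves[OF Vs(2,3) bc abc] by simp
    next
      case False
      then have bw: "col b w = col c u" using bcu'[OF Rs(2)] by argo
      then have cw: "col c w = col b u" using bcu'[OF Rs(3)] bcw by argo
      \<comment> \<open>If \<open>a\<close> copies \<open>b\<close> or \<open>c\<close>, then
        \<open>u\<close> and \<open>w\<close> are middles over the same leaves and share a column,
        which the swapped colours exclude by \<open>vertical_two_matchings\<close>.\<close>
      have no: False if "z \<in> {b, c}" "col a u = col z u" "col a w = col z w" for z
      proof -
        have "a \<noteq> z" "z \<in> V" using that(1) dist Vs by auto
        have "col u a = col u z" "col w a = col w z"
          using that(2,3) by (simp_all only: col_commute[of u] col_commute[of w])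
        then have "x u = x w"
          by (rule cherry_same_leaves[OF _ \<open>a \<noteq> z\<close>, rotated]) (use Vs \<open>z \<in> V\<close> in auto)
        moreover have "col u b = col w c" "col w b = col u c"
          using bw cw by (simp_all only: col_commute[of u] col_commute[of w])
        ultimately show False using vertical_two_matchings[OF V2(2)] uw by blast
      qed
      show False
      proof (cases "col a u = col a w")
        case True
        then show False using star_2_2[OF V bc uw abc] bw cw by metis
      next
        case False
        then show False using no[of b] no[of c] bcu'[OF Rs(1)] bcu'[OF Rs(4)] bw cw by auto
      qed
    qed
  qed
qed

text \<open>No end of \<open>b c\<close> is a middle over \<open>u w\<close>, nor \<open>u\<close>
  over \<open>b c\<close>, so the two colours of \<open>R\<close> form matchings between these
  edges. A cherry at \<open>a\<close> over \<open>u w\<close> would require a third colour; hence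
  \<open>a\<close> copies \<open>b\<close> or \<open>c\<close>, and \<open>u\<close>,
  \<open>w\<close> share a column.\<close>

lemma no_3_2_rainbow:
  assumes V: "{a, b, c, u, w} \<subseteq> V" and dist: "distinct [a, b, c, u, w]"
    and fin: "finite R" and card: "card R \<le> 2"
    and R: "{col a u, col b u, col c u, col a w, col b w, col c w} \<subseteq> R"
    and bc: "col u w = col b c"
  shows False
proof -
  have Vs: "a \<in> V" "b \<in> V" "c \<in> V" "u \<in> V" "w \<in> V" using V by auto
  have ne: "b \<noteq> c" "u \<noteq> w" "a \<noteq> b" "a \<noteq> c" using dist by auto
  have V2: "{b, c} \<subseteq> V" "{u, w} \<subseteq> V" using Vs by auto
  have uwcb: "col u w = col c b" using bc by (simp only: col_commute[of c])
  have bu: "col b u \<noteq> col b w"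
  proof
    assume "col b u = col b w"
    from cherry_base[OF V2(2) ne(2) this refl bc refl] show False by simp
  qed
  have cu: "col c u \<noteq> col c w"
  proof
    assume "col c u = col c w"
    from cherry_base[OF V2(2) ne(2) this refl uwcb refl] show False by simp
  qed
  have bcu: "col b u \<noteq> col c u"
  proof
    assume "col b u = col c u"
    then have "col u b = col u c" by (simp only: col_commute[of u])
    from cherry_base[OF V2(1) ne(1) this refl bc[symmetric] refl] show False by simp
  qed
  have "col b u \<in> R" "col b w \<in> R" "col c u \<in> R" "col c w \<in> R" "col a u \<in> R" "col a w \<in> R"
    using R by auto
  note Rs = this
  have R2: "z = col b u \<or> z = col b w" if "z \<in> R" for z
    using card_le_2_cases[OF fin card, of z "col b u" "col b w"] that Rs bu by blast
  have m: "col c u = col b w" "col c w = col b u"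
    using R2[OF Rs(3)] R2[OF Rs(4)] bcu cu by argo+
  have no: False if "z \<in> {b, c}" "col a u = col z u" "col a w = col z w" for z
  proof -
    have "a \<noteq> z" "z \<in> V" using that(1) ne Vs by auto
    have "col u a = col u z" "col w a = col w z"
      using that(2,3) by (simp_all only: col_commute[of u] col_commute[of w])
    then have "x u = x w"
      by (rule cherry_same_leaves[OF _ \<open>a \<noteq> z\<close>, rotated]) (use Vs \<open>z \<in> V\<close> in auto)
    moreover have "col u b = col w c" "col w b = col u c"
      using m by (simp_all only: col_commute[of u] col_commute[of w])
    ultimately show False using vertical_two_matchings[OF V2(2)] ne(2) by blast
  qed
  have "col a u \<noteq> col a w"
  proof
    assume eq: "col a u = col a w"
    have wu: "col u w = col w u" by (rule col_commute)
    from cherry_base[OF V2(2) ne(2) eq refl bc refl] cherry_base[OF V2(2) ne(2) eq refl bc wu]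
    show False using R2[OF Rs(5)] by argo
  qed
  then show False using R2[OF Rs(5)] R2[OF Rs(6)] no[of b] no[of c] m by auto
qed

text \<open>The triangle has three colours because it contains no cherry. A single crossing colour
  would put \<open>u\<close> and \<open>w\<close> in one column, though they are leaves of a cherry.
  So the counts are 2 and 3, and \<open>u w\<close> repeats a triangle colour.\<close>

lemma no_3_2:
  assumes V: "{a, b, c, u, w} \<subseteq> V" and dist: "distinct [a, b, c, u, w]"
    and x: "\<And>r s. r \<in> {a, b, c} \<Longrightarrow> s \<in> {u, w} \<Longrightarrow> x r \<noteq> x s"
    and fin: "finite R" "finite T" and card: "card R + card T \<le> 5"
    and R: "{col a u, col b u, col c u, col a w, col b w, col c w} \<subseteq> R"
    and T: "{col a b, col a c, col b c, col u w} \<subseteq> T"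
  shows False
proof -
  have Vs: "a \<in> V" "b \<in> V" "c \<in> V" "u \<in> V" "w \<in> V" using V by auto
  have V': "{b, a, c, u, w} \<subseteq> V" "{c, a, b, u, w} \<subseteq> V" using Vs by simp_all
  have dist': "distinct [b, a, c, u, w]" "distinct [c, a, b, u, w]" using dist by auto
  note com = col_commute[of b a] col_commute[of c a] col_commute[of c b]
  have R': "{col b u, col a u, col c u, col b w, col a w, col c w} \<subseteq> R"
    "{col c u, col a u, col b u, col c w, col a w, col b w} \<subseteq> R" using R by simp_all
  have T': "{col b a, col b c, col a c, col u w} \<subseteq> T" "{col c a, col c b, col a b, col u w} \<subseteq> T"
    using T unfolding com by simp_all
  have n: "col a b \<noteq> col a c" "col a b \<noteq> col b c" "col a c \<noteq> col b c"
    using no_3_2_cherry[OF V dist x x fin card R T] no_3_2_cherry[OF V'(1) dist'(1) x x fin card R'(1) T'(1)]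
      no_3_2_cherry[OF V'(2) dist'(2) x x fin card R'(2) T'(2)]
    unfolding com by blast+
  have "\<not> card R \<le> 1"
  proof
    assume "card R \<le> 1"
    then have eq: "z = z'" if "z \<in> R" "z' \<in> R" for z z'
      using that fin(1) card_le_Suc0_iff_eq by auto
    have "col a u = col a w" "col a u = col b u" "col a w = col b w" by (rule eq; use R in blast)+
    then have "col u a = col u b" "col w a = col w b"
      by (simp_all only: col_commute[of u] col_commute[of w])
    then have "x u = x w"
      by (rule cherry_same_leaves[rotated 2]) (use Vs dist in auto)
    then show False using cherry_x_leaves[OF Vs(4,5) _ \<open>col a u = col a w\<close>] dist by simp
  qed
  moreover have "card {col a b, col a c, col b c} \<le> card T"
    by (rule card_mono[OF fin(2)]) (use T in auto)
  then have "3 \<le> card T" using n by simp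
  ultimately have card2: "card R \<le> 2" "card T \<le> 3" using card by auto
  have "col u w = col a b \<or> col u w = col a c \<or> col u w = col b c"
    using card_le_3_cases[OF fin(2) card2(2), of "col u w" "col a b" "col a c" "col b c"] T n by simp
  then show False
    using no_3_2_rainbow[OF V dist fin(1) card2(1) R] no_3_2_rainbow[OF V'(1) dist'(1) fin(1) card2(1) R'(1)]
      no_3_2_rainbow[OF V'(2) dist'(2) fin(1) card2(1) R'(2)] by argo
qed

end

section \<open>Five vertices see six colours\<close>

lemma card_4_obtain:
  assumes "card A = 4"
  obtains a b c d where "A = {a, b, c, d}" "distinct [a, b, c, d]"
proof -
  have "finite A" using assms card.infinite by fastforce
  then obtain xs where xs: "set xs = A" "distinct xs" using finite_distinct_list by blast
  then have "length xs = 4" using assms distinct_card by metis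
  then obtain a b c d where "xs = [a, b, c, d]"
    by (auto simp: numeral_eq_Suc length_Suc_conv)
  then show thesis using that xs by auto
qed

context construction
begin

definition colors_on :: "'v set \<Rightarrow> (int \<times> nat \<times> nat \<times> nat \<times> nat list) set" where
  "colors_on S = {col v w | v w. v \<in> S \<and> w \<in> S \<and> v \<noteq> w}"

lemma finite_colors_on: "finite S \<Longrightarrow> finite (colors_on S)"
  by (rule finite_subset[of _ "(\<lambda>(v, w). col v w) ` (S \<times> S)"]) (auto simp: colors_on_def)

lemma colors_on_I: "v \<in> S \<Longrightarrow> w \<in> S \<Longrightarrow> v \<noteq> w \<Longrightarrow> col v w \<in> colors_on S"
  by (auto simp: colors_on_def)

text \<open>
  With all \<open>x\<close> equal, colours amount to sums of two \<open>y\<close>-values; the sums with the minimum and those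
  with the maximum are already six.
\<close>

lemma vertical_five:
  assumes S: "S \<subseteq> V" "card S = 5" and x: "\<And>v w. v \<in> S \<Longrightarrow> w \<in> S \<Longrightarrow> x v = x w"
  shows "6 \<le> card (colors_on S)"
proof -
  have fin: "finite S" "S \<noteq> {}" using S(2) card.infinite by fastforce+
  have inj: "inj_on y S"
    using coords_inj S(1) x by (intro inj_onI) blast
  have im: "finite (y ` S)" "y ` S \<noteq> {}" using fin by auto
  obtain m where m: "m \<in> S" "y m = Min (y ` S)" using Min_in[OF im] by auto
  obtain M where M: "M \<in> S" "y M = Max (y ` S)" using Max_in[OF im] by auto
  have mM: "y m \<le> y z" "y z \<le> y M" if "z \<in> S" for z
    using that im m(2) M(2) by simp_all
  have "m \<noteq> M"
  proof
    assume "m = M"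
    then have "y z = y m" if "z \<in> S" for z using mM[OF that] by simp
    then have "z = m" if "z \<in> S" for z using inj_onD[OF inj _ that m(1)] that by simp
    then have "S \<subseteq> {m}" by blast
    then show False using S(2) card_mono[of "{m}" S] by simp
  qed
  then have "card (S - {m, M}) = 3" using S(2) m(1) M(1) by (simp add: card_Diff_subset)
  then obtain a b c where abc: "S - {m, M} = {a, b, c}" "a \<noteq> b" "b \<noteq> c" "a \<noteq> c"
    by (metis card_3_iff)
  have between: "y m < y z" "y z < y M" if "z \<in> {a, b, c}" for z
  proof -
    have "z \<in> S" "z \<noteq> m" "z \<noteq> M" using that abc(1) by auto
    moreover have "y z \<noteq> y m" "y z \<noteq> y M"
      using calculation inj_onD[OF inj _ \<open>z \<in> S\<close>] m(1) M(1) by blast+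
    ultimately show "y m < y z" "y z < y M" using mM[of z] by simp_all
  qed
  have inS: "a \<in> S" "b \<in> S" "c \<in> S" using abc(1) by auto
  have ys: "y a \<noteq> y b" "y b \<noteq> y c" "y a \<noteq> y c"
    using abc(2-4) inS inj_onD[OF inj] by blast+
  have ne: "col v w \<noteq> col v' w'"
    if "v \<in> S" "w \<in> S" "v' \<in> S" "w' \<in> S" "y v + y w \<noteq> y v' + y w'" for v w v' w'
  proof
    assume "col v w = col v' w'"
    moreover have "x v = x w" "x v = x v'" "x v = x w'" using x that by blast+
    ultimately have "int p dvd Y v' + Y w' - (Y v + Y w)"
      using col_dvd[of v w v' w'] by (simp add: algebra_simps)
    moreover have vV: "v \<in> V" "w \<in> V" "v' \<in> V" "w' \<in> V" using that S(1) by auto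
    have "\<bar>Y v' + Y w' - (Y v + Y w)\<bar> < int p"
      using y_less[of v] y_less[of w] y_less[of v'] y_less[of w'] vV by linarith
    ultimately have "Y v' + Y w' - (Y v + Y w) = 0" by (rule dvd_less_imp_0)
    then show False using that(5) by linarith
  qed
  have ba: "y m < y a" "y a < y M" "y m < y b" "y b < y M" "y m < y c" "y c < y M"
    using between by auto
  have "col m a \<noteq> col m b" "col m b \<noteq> col m c" "col m a \<noteq> col m c"
    "col a M \<noteq> col b M" "col b M \<noteq> col c M" "col a M \<noteq> col c M"
    by (rule ne[OF m(1) inS(1) m(1) inS(2)] ne[OF m(1) inS(2) m(1) inS(3)]
        ne[OF m(1) inS(1) m(1) inS(3)] ne[OF inS(1) M(1) inS(2) M(1)]
        ne[OF inS(2) M(1) inS(3) M(1)] ne[OF inS(1) M(1) inS(3) M(1)]; use ys in simp)+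
  moreover have "col m u \<noteq> col w M" if "u \<in> {a, b, c}" "w \<in> {a, b, c}" for u w
  proof (rule ne)
    show "y m + y u \<noteq> y w + y M" using between[OF that(1)] between[OF that(2)] by linarith
  qed (use m(1) M(1) inS that in auto)
  note this[of a a] this[of a b] this[of a c] this[of b a] this[of b b] this[of b c]
    this[of c a] this[of c b] this[of c c]
  ultimately have "distinct [col m a, col m b, col m c, col a M, col b M, col c M]" (is "distinct ?xs")
    by simp
  moreover have "set ?xs \<subseteq> colors_on S"
    using m(1) M(1) inS ba by (simp, intro conjI colors_on_I) auto
  ultimately show ?thesis
    using card_mono[OF finite_colors_on[OF fin(1)], of "set ?xs"] distinct_card[of ?xs] by simp
qed

lemma no_split:
  assumes S: "A \<union> B \<subseteq> V" "A \<inter> B = {}" and card: "card A = 4 \<and> card B = 1 \<or> card A = 3 \<and> card B = 2"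
    and x: "\<And>a b. a \<in> A \<Longrightarrow> b \<in> B \<Longrightarrow> x a \<noteq> x b"
    and fin: "finite R" "finite T" and RT: "card R + card T \<le> 5"
    and R: "\<And>a b. a \<in> A \<Longrightarrow> b \<in> B \<Longrightarrow> col a b \<in> R"
    and T: "\<And>a b. {a, b} \<subseteq> A \<or> {a, b} \<subseteq> B \<Longrightarrow> a \<noteq> b \<Longrightarrow> col a b \<in> T"
  shows False
  using card
proof
  assume c: "card A = 4 \<and> card B = 1"
  obtain v where v: "B = {v}" using c card_1_singletonE by blast
  obtain a b c d where A: "A = {a, b, c, d}" "distinct [a, b, c, d]"
    using c card_4_obtain by blast
  show False
  proof (rule no_star[of v a b c d R T])
    show "{col v a, col v b, col v c, col v d} \<subseteq> R"
      using R v A(1) by (simp add: col_commute[of v])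
  qed (use S v A fin RT T in auto)
next
  assume c: "card A = 3 \<and> card B = 2"
  obtain a b c where A: "A = {a, b, c}" "a \<noteq> b" "b \<noteq> c" "a \<noteq> c" using c by (metis card_3_iff)
  obtain u w where B: "B = {u, w}" "u \<noteq> w" using c by (metis card_2_iff)
  show False
  proof (rule no_3_2[of a b c u w R T])
    show "x r \<noteq> x s" if "r \<in> {a, b, c}" "s \<in> {u, w}" for r s using x that A(1) B(1) by blast
  qed (use S A B fin RT R T in auto)
qed

lemma five_vertices_six_colors:
  assumes S: "S \<subseteq> V" "card S = 5"
  shows "6 \<le> card (colors_on S)"
proof (cases "\<forall>v\<in>S. \<forall>w\<in>S. x v = x w")
  case True
  then show ?thesis using vertical_five[OF S] by blast
next
  case False
  then obtain v w where vw: "v \<in> S" "w \<in> S" "x v \<noteq> x w" by blast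
  have fin: "finite S" using S(2) card.infinite by fastforce
  show ?thesis
  proof (rule ccontr)
    assume less: "\<not> 6 \<le> card (colors_on S)"
    show False
    proof (rule tree_split[OF fin S(1) vw])
      fix A B
      assume AB: "S = A \<union> B" "A \<inter> B = {}" "A \<noteq> {}" "B \<noteq> {}"
        and x: "\<And>a b. a \<in> A \<Longrightarrow> b \<in> B \<Longrightarrow> x a \<noteq> x b"
        and sep: "\<And>a b c d. a \<in> A \<Longrightarrow> b \<in> B \<Longrightarrow> {c, d} \<subseteq> A \<or> {c, d} \<subseteq> B \<Longrightarrow> col a b \<noteq> col c d"
      \<comment> \<open>Crossing and inner colours are disjoint, so a set with at most five colours
        has \<open>card R + card T\<close> at most 5.\<close>
      define R where "R = {col a b | a b. a \<in> A \<and> b \<in> B}"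
      define T where "T = colors_on A \<union> colors_on B"
      have finAB: "finite A" "finite B" using fin AB(1) by auto
      have "R \<subseteq> colors_on S" "T \<subseteq> colors_on S"
        using AB(1,2) unfolding R_def T_def colors_on_def by blast+
      moreover have "R \<inter> T = {}"
      proof (rule ccontr)
        assume "R \<inter> T \<noteq> {}"
        then obtain a b c d where "a \<in> A" "b \<in> B" "{c, d} \<subseteq> A \<or> {c, d} \<subseteq> B" "col a b = col c d"
          unfolding R_def T_def colors_on_def by blast
        then show False using sep by blast
      qed
      moreover note finE = finite_colors_on[OF fin]
      ultimately have finRT: "finite R" "finite T" and "card R + card T \<le> card (colors_on S)"
        using finite_subset[OF _ finE] card_Un_disjoint[of R T] card_mono[OF finE, of "R \<union> T"]
        by auto
      then have RT: "card R + card T \<le> 5" using less by linarith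
      have "card A + card B = 5" using AB S(2) card_Un_disjoint[OF finAB] by simp
      moreover have "card A > 0" "card B > 0" using AB(3,4) finAB by (auto simp: card_gt_0_iff)
      ultimately consider "card A = 4 \<and> card B = 1 \<or> card A = 3 \<and> card B = 2"
        | "card B = 4 \<and> card A = 1 \<or> card B = 3 \<and> card A = 2" by linarith
      then show False
      proof cases
        case 1
        show False
          by (rule no_split[OF _ AB(2) 1 x finRT RT])
            (use AB(1) S(1) in \<open>auto simp: R_def T_def intro: colors_on_I\<close>)
      next
        case 2
        have BA: "B \<union> A \<subseteq> V" "B \<inter> A = {}" using AB(1,2) S(1) by auto
        have R': "col b a \<in> R" if "b \<in> B" "a \<in> A" for a b
          using that col_commute[of b a] unfolding R_def by blast
        have x': "x b \<noteq> x a" if "b \<in> B" "a \<in> A" for a b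
          using x[OF that(2,1)] by simp
        have T': "col a b \<in> T" if "{a, b} \<subseteq> B \<or> {a, b} \<subseteq> A" "a \<noteq> b" for a b
          using that unfolding T_def by (auto intro: colors_on_I)
        show False by (rule no_split[OF BA 2 x' finRT RT R' T'])
      qed
    qed
  qed
qed

end

lemma ex_coloring:
  assumes p: "prime p" "2 < p" and n: "4 * n \<le> p * p" and t: "p \<le> 2 ^ (t * t)"
  shows "\<exists>c. pq_coloring n 5 6 c \<and>
    card (c ` [{..<n}]\<^bsup>2\<^esup>) \<le> p * (t * t + 1) * 2 ^ t * 2 ^ t * (t + 1) ^ t"
proof -
  \<comment> \<open>The number of \<open>z\<close> with \<open>2 * z < p\<close>. The vertices fill
    an \<open>h\<close> by \<open>h\<close> grid row by row.\<close>
  define h where "h = (p + 1) div 2"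
  have h: "h > 0" "p \<le> 2 * h" "2 * h \<le> p + 1" using p(2) unfolding h_def by linarith+
  have "4 * n \<le> 4 * (h * h)" using n mult_le_mono[OF h(2) h(2)] by simp
  then have n_le: "n \<le> h * h" by simp
  interpret construction p t "{..<n}" "\<lambda>v. v mod h" "\<lambda>v. v div h"
  proof
    show "prime p" "2 < p" by fact+
    fix v w assume v: "v \<in> {..<n}"
    have *: "2 * z < p" if "z < h" for z using that h(3) by linarith
    show x: "2 * (v mod h) < p" using * h(1) by simp
    show "2 * (v div h) < p"
      by (rule *) (use v n_le in \<open>auto intro: less_mult_imp_div_less\<close>)
    show "v mod h < 2 ^ (t * t)" using x t by linarith
    show "v mod h = w mod h \<Longrightarrow> v div h = w div h \<Longrightarrow> v = w" by (metis div_mult_mod_eq)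
  qed
  \<comment> \<open>\<open>Min\<close> and \<open>Max\<close> pick the two ends of an edge; as
    \<open>col\<close> is symmetric, their order is immaterial.\<close>
  define c where "c e = to_nat (col (Min e) (Max e))" for e :: "nat set"
  have c: "c {v, w} = to_nat (col v w)" for v w
    unfolding c_def using col_commute by (cases v w rule: linorder_cases) (auto simp: min_def max_def)
  have pq: "pq_coloring n 5 6 c"
    unfolding pq_coloring_def
  proof
    fix S assume "S \<in> [{..<n}]\<^bsup>5\<^esup>"
    then have S: "S \<subseteq> {..<n}" "finite S" "card S = 5" by (auto simp: nsets_def)
    have sub: "to_nat ` colors_on S \<subseteq> c ` [S]\<^bsup>2\<^esup>"
    proof
      fix k assume "k \<in> to_nat ` colors_on S"
      then obtain v w where vw: "v \<in> S" "w \<in> S" "v \<noteq> w" "k = to_nat (col v w)"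
        by (auto simp: colors_on_def)
      then have "{v, w} \<in> [S]\<^bsup>2\<^esup>" by (auto simp: nsets_def)
      then show "k \<in> c ` [S]\<^bsup>2\<^esup>" using vw(4) c by (metis imageI)
    qed
    have "6 \<le> card (colors_on S)" by (rule five_vertices_six_colors[OF S(1,3)])
    also have "\<dots> = card (to_nat ` colors_on S)"
      by (rule card_image[symmetric]) (simp add: inj_on_def)
    also have "\<dots> \<le> card (c ` [S]\<^bsup>2\<^esup>)"
      by (rule card_mono[OF finite_imageI[OF finite_imp_finite_nsets[OF S(2)]] sub])
    finally show "6 \<le> card (c ` [S]\<^bsup>2\<^esup>)" .
  qed
  \<comment> \<open>The factors count residues, branching levels, the smaller and the larger digit,
    and the lists of \<open>t\<close> levels inside digits.\<close>
  define U where "U = {0..<int p} \<times> {..t * t} \<times> {..<2 ^ t :: nat} \<times> {..<2 ^ t :: nat}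
    \<times> {xs. set xs \<subseteq> {..t} \<and> length xs = t}"
  have finU: "finite U" unfolding U_def by (simp add: finite_lists_length_eq)
  have "c ` [{..<n}]\<^bsup>2\<^esup> \<subseteq> to_nat ` U"
  proof
    fix k assume "k \<in> c ` [{..<n}]\<^bsup>2\<^esup>"
    then obtain e where e: "e \<in> [{..<n}]\<^bsup>2\<^esup>" "k = c e" by blast
    then obtain v w where vw: "e = {v, w}" "v \<in> {..<n}" "w \<in> {..<n}"
      by (auto simp: nsets_def card_2_iff)
    have "top_diff (v mod h) (w mod h) \<le> t * t"
      by (intro top_diff_le x_bits vw)
    moreover have "top_diff (digit t j a) (digit t j b) \<le> t" for j a b
      by (intro top_diff_le digit_less)
    ultimately have "col v w \<in> U"
      using p(2) unfolding U_def col_def tree_color_def Let_def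
      by (auto simp: digit_less min_def max_def)
    then show "k \<in> to_nat ` U" using e(2) vw(1) c by simp
  qed
  then have "card (c ` [{..<n}]\<^bsup>2\<^esup>) \<le> card (to_nat ` U)"
    by (rule card_mono[OF finite_imageI[OF finU]])
  also have "\<dots> \<le> card U" by (rule card_image_le[OF finU])
  also have "\<dots> = p * (t * t + 1) * 2 ^ t * 2 ^ t * (t + 1) ^ t"
    unfolding U_def by (simp add: card_cartesian_product card_lists_length_eq algebra_simps)
  finally show ?thesis using pq by blast
qed

section \<open>Primes in short intervals\<close>

text \<open>
  The entries \<open>1 / ((n + 1) * (n choose k))\<close> of Leibniz' harmonic triangle satisfy a Pascal-type
  recurrence, so they all are integer combinations of \<open>1, 1/2, \<dots>, 1/(n + 1)\<close>.
\<close>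

lemma Suc_times_binomial_dvd_Lcm:
  "k \<le> n \<Longrightarrow> Suc n * (n choose k) dvd (Lcm {1..Suc n} :: nat)"
proof (induction k arbitrary: n)
  case 0
  then show ?case by (simp add: dvd_Lcm)
next
  case (Suc k)
  then obtain m where m: "n = Suc m" by (cases n) auto
  \<comment> \<open>The recurrence of the triangle reads \<open>1/a = 1/b - 1/c\<close>, so
    \<open>D/a\<close> equals the integer \<open>u - v\<close>.\<close>
  define a b c D where "a = Suc n * (n choose Suc k)" and "b = Suc m * (m choose k)"
    and "c = Suc n * (n choose k)" and "D = (Lcm {1..Suc n} :: nat)"
  have km: "k \<le> m" using Suc.prems m by simp
  have "b dvd Lcm {1..Suc m}" using Suc.IH[OF km] b_def by simp
  also have "\<dots> dvd D" unfolding D_def m by (rule Lcm_subset) auto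
  finally obtain u where u: "D = b * u" by (elim dvdE)
  have "c dvd D" using Suc.IH[of n] Suc.prems unfolding c_def D_def by simp
  then obtain v where v: "D = c * v" by (elim dvdE)
  have "real (Suc k) * real (n choose Suc k) = real b"
    unfolding b_def m by (metis Suc_times_binomial of_nat_mult)
  then have a: "real (Suc k) * real a = real (Suc n) * real b"
    unfolding a_def by (simp add: algebra_simps)
  have "(n - k) * (n choose k) = b"
    using binomial_absorb_comp[of n k] m b_def by simp
  then have "real (n - k) * real (n choose k) = real b" by (metis of_nat_mult)
  then have c: "(real n - real k) * real c = real (Suc n) * real b"
    unfolding c_def using Suc.prems by (simp add: algebra_simps of_nat_diff)
  have pos: "real c > 0" "real b > 0" "real n - real k > 0" "real (Suc k) > 0"
    using Suc.prems km zero_less_binomial[of k n] zero_less_binomial[of k m]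
    unfolding c_def b_def of_nat_0_less_iff by simp_all
  have n: "real (Suc n) = real (Suc k) + (real n - real k)" by simp
  have "(real a * (real c - real b)) * (real (Suc k) * (real n - real k))
    = (real b * real c) * (real (Suc k) * (real n - real k))"
    using a c n by algebra
  then have "real a * (real c - real b) = real b * real c"
    using pos(3,4) by simp
  moreover have "real D = real b * real u" "real D = real c * real v"
    using u v by (metis of_nat_mult)+
  ultimately have "real a * (real u - real v) * (real b * real c) = real D * (real b * real c)"
    by algebra
  then have "real a * (real u - real v) = real D"
    using pos(1,2) by simp
  then have "real_of_int (int a * (int u - int v)) = real_of_int (int D)" by simp
  then have "int a * (int u - int v) = int D" by (simp only: of_int_eq_iff)
  then have "int a dvd int D" by (metis dvd_triv_left)
  then show ?case unfolding a_def D_def by (simp only: of_nat_dvd_iff)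
qed

text \<open>The central entry of row \<open>2 * m\<close> is a divisor of at least
  \<open>4 ^ m\<close>, since \<open>(2 * m) choose m\<close> is at least
  \<open>4 ^ m / (2 * m)\<close>.\<close>

lemma Lcm_ge_4_power: "4 ^ m \<le> (Lcm {1..2 * m + 1} :: nat)"
proof (cases "m = 0")
  case False
  have "4 ^ m / (2 * real m) \<le> real ((2 * m) choose m)"
    using central_binomial_lower_bound False by simp
  then have "4 ^ m \<le> 2 * real m * real ((2 * m) choose m)"
    using False by (simp add: field_simps)
  also have "\<dots> \<le> real (Suc (2 * m) * ((2 * m) choose m))" by simp
  finally have "4 ^ m \<le> Suc (2 * m) * ((2 * m) choose m)"
    by (metis of_nat_le_iff of_nat_numeral of_nat_power)
  also have "\<dots> \<le> Lcm {1..Suc (2 * m)}"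
    by (rule dvd_imp_le[OF Suc_times_binomial_dvd_Lcm]) (auto simp: Lcm_0_iff intro: Nat.gr0I)
  finally show ?thesis by simp
qed simp

text \<open>Each prime up to \<open>N\<close> enters the lcm with its largest power not exceeding
  \<open>N\<close>, so it contributes a factor of at most \<open>N\<close>.\<close>

lemma Lcm_le_power_primes:
  "(Lcm {1..N} :: nat) \<le> N ^ card {p. prime p \<and> p \<le> N}"
proof (cases "N = 0")
  case False
  define P where "P = {p. prime p \<and> p \<le> N}"
  have P: "finite P" "\<And>p. p \<in> P \<Longrightarrow> prime p" unfolding P_def by auto
  define e where "e p = (GREATEST e. p ^ e \<le> N)" for p
  have bound: "k \<le> N" if "prime p" "p ^ k \<le> N" for p k
  proof -
    have "k < 2 ^ k" by (rule less_exp)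
    also have "\<dots> \<le> p ^ k" using prime_ge_2_nat[OF that(1)] by (rule power_mono) simp
    finally show ?thesis using that(2) by simp
  qed
  have e: "p ^ e p \<le> N" if "p \<in> P" for p
    unfolding e_def
    by (rule GreatestI_nat[of _ 0 N]) (use P(2)[OF that] False bound in auto)
  have "Lcm {1..N} dvd (\<Prod>p\<in>P. p ^ e p)"
  proof (rule Lcm_least)
    fix k assume k: "k \<in> {1..N}"
    show "k dvd (\<Prod>p\<in>P. p ^ e p)"
    proof (rule multiplicity_le_imp_dvd)
      fix p :: nat assume p: "prime p"
      have "p ^ multiplicity p k \<le> k" using k multiplicity_dvd[of p k] by (auto intro: dvd_imp_le)
      then have le: "p ^ multiplicity p k \<le> N" using k by simp
      show "multiplicity p k \<le> multiplicity p (\<Prod>p\<in>P. p ^ e p)"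
      proof (cases "p \<in> P")
        case True
        have "multiplicity p k \<le> e p"
          unfolding e_def by (rule Greatest_le_nat[of _ _ N]) (use le p bound in auto)
        then show ?thesis using True P p by (simp add: multiplicity_prod_prime_powers)
      next
        case False
        have "multiplicity p k = 0"
        proof (rule ccontr)
          assume "multiplicity p k \<noteq> 0"
          then have "p ^ 1 \<le> p ^ multiplicity p k"
            using p prime_gt_0_nat[of p] by (intro power_increasing) auto
          then show False using le False p P_def by simp
        qed
        then show ?thesis by simp
      qed
    qed (use k in auto)
  qed
  then have "Lcm {1..N} \<le> (\<Prod>p\<in>P. p ^ e p)"
    using P prime_gt_0_nat by (intro dvd_imp_le prod_pos) auto
  also have "\<dots> \<le> (\<Prod>p\<in>P. N)" by (rule prod_mono) (use e in auto)
  also have "\<dots> = N ^ card P" by simp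
  finally show ?thesis unfolding P_def .
next
  case True
  then have "{p. prime p \<and> p \<le> N} = {}" by auto
  then show ?thesis using True by (simp only: card.empty) simp
qed

lemma double_mult_plus_1_less_power4:
  assumes "3 \<le> l"
  shows "2 * (2 ^ l * l) + 1 < (4 ^ l :: nat)"
proof -
  have "2 * k + 1 \<le> 2 ^ k" if "3 \<le> k" for k :: nat
    using that by (induction k rule: nat_induct_at_least) auto
  then have "2 ^ l * (2 * l + 1) \<le> 2 ^ l * (2 ^ l :: nat)" using assms by (intro mult_le_mono) auto
  moreover have "(1::nat) < 2 ^ l" using assms by (intro one_less_power) auto
  moreover have four: "4 ^ l = 2 ^ l * (2 ^ l :: nat)" by (simp flip: power_mult_distrib)
  ultimately show "2 * (2 ^ l * l) + 1 < (4 ^ l :: nat)"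
    unfolding four by (simp add: algebra_simps)
qed

text \<open>If all primes up to \<open>N\<close> were at most \<open>2 ^ l\<close>, the two lcm
  bounds would give \<open>4 ^ (2 ^ l * l) <= N ^ (2 ^ l)\<close>, against \<open>N < 4 ^ l\<close>.
  Compared with Bertrand's postulate the interval is longer by a factor of order \<open>l\<close>,
  which costs only a logarithm in the colour count.\<close>

lemma ex_prime_between:
  assumes "3 \<le> l"
  obtains p where "prime p" "2 ^ l < p" "p \<le> 2 * (2 ^ l * l) + (1::nat)"
proof (rule ccontr)
  assume "\<not> thesis"
  define N :: nat where "N = 2 * (2 ^ l * l) + 1"
  have "{p. prime p \<and> p \<le> N} \<subseteq> {1..2 ^ l}"
  proof
    fix p assume "p \<in> {p. prime p \<and> p \<le> N}"
    then show "p \<in> {1..2 ^ l}"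
      using that[of p] \<open>\<not> thesis\<close> prime_ge_1_nat[of p] leI[of p "2 ^ l"]
      unfolding N_def by (metis atLeastAtMost_iff mem_Collect_eq not_less)
  qed
  then have card: "card {p. prime p \<and> p \<le> N} \<le> 2 ^ l"
    using card_mono[of "{1..2 ^ l::nat}"] by fastforce
  have "N < 4 ^ l" unfolding N_def by (rule double_mult_plus_1_less_power4[OF assms])
  have "4 ^ (2 ^ l * l) \<le> (Lcm {1..N} :: nat)"
    using Lcm_ge_4_power unfolding N_def .
  also have "\<dots> \<le> N ^ card {p. prime p \<and> p \<le> N}" by (rule Lcm_le_power_primes)
  also have "\<dots> \<le> N ^ (2 ^ l)" by (rule power_increasing[OF card]) (simp add: N_def)
  also have "\<dots> < (4 ^ l) ^ (2 ^ l)" by (rule power_strict_mono[OF \<open>N < 4 ^ l\<close>]) auto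
  also have "\<dots> = 4 ^ (2 ^ l * l)" by (simp add: mult.commute flip: power_mult)
  finally show False by simp
qed

section \<open>The lower bound\<close>

text \<open>Applied to the neighbours of vertex \<open>0\<close> in colour \<open>i\<close>: adding
  \<open>0\<close> to a four-set of them adds no colour but \<open>i\<close>.\<close>

locale four_sets_five_colors =
  fixes N :: "'v set" and c :: "'v set \<Rightarrow> 'c" and i :: 'c
  assumes fin: "finite N" and card_ge_4: "4 \<le> card N"
    and five: "\<And>Q. Q \<in> [N]\<^bsup>4\<^esup> \<Longrightarrow> 5 \<le> card (c ` [Q]\<^bsup>2\<^esup> - {i})"
begin

text \<open>A four-set has six edges and five colours other than \<open>i\<close>, so at most one
  edge can be redundant, by repeating a colour or by having colour \<open>i\<close>.\<close>

lemma no_two_repeats: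
  assumes Q: "Q \<in> [N]\<^bsup>4\<^esup>" and d: "d \<in> [Q]\<^bsup>2\<^esup>" "d' \<in> [Q]\<^bsup>2\<^esup>" "d \<noteq> d'"
    and r: "c d = i \<or> (\<exists>e\<in>[Q]\<^bsup>2\<^esup> - {d, d'}. c e = c d)"
      "c d' = i \<or> (\<exists>e\<in>[Q]\<^bsup>2\<^esup> - {d, d'}. c e = c d')"
  shows False
proof -
  have finQ: "finite Q" "card Q = 4" using Q by (auto simp: nsets_def)
  have fin2: "finite ([Q]\<^bsup>2\<^esup>)" by (rule finite_imp_finite_nsets[OF finQ(1)])
  have "c ` [Q]\<^bsup>2\<^esup> - {i} \<subseteq> c ` ([Q]\<^bsup>2\<^esup> - {d, d'})"
  proof
    fix z assume "z \<in> c ` [Q]\<^bsup>2\<^esup> - {i}"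
    then obtain e where "e \<in> [Q]\<^bsup>2\<^esup>" "z = c e" "c e \<noteq> i" by blast
    then show "z \<in> c ` ([Q]\<^bsup>2\<^esup> - {d, d'})"
      using r by (cases "e = d \<or> e = d'") (metis image_eqI, blast)
  qed
  then have "card (c ` [Q]\<^bsup>2\<^esup> - {i}) \<le> card (c ` ([Q]\<^bsup>2\<^esup> - {d, d'}))"
    using fin2 by (intro card_mono) auto
  also have "\<dots> \<le> card ([Q]\<^bsup>2\<^esup> - {d, d'})" using fin2 by (intro card_image_le) auto
  also have "\<dots> = card ([Q]\<^bsup>2\<^esup>) - 2" using d fin2 by (simp add: card_Diff_subset)
  also have "card ([Q]\<^bsup>2\<^esup>) = 6" using finQ by (simp add: card_nsets choose_two)
  finally show False using five[OF Q] by simp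
qed

lemma extend_four:
  assumes "W \<subseteq> N" "card W \<le> 4"
  obtains Q where "Q \<in> [N]\<^bsup>4\<^esup>" "W \<subseteq> Q"
proof -
  obtain Q where "W \<subseteq> Q" "Q \<subseteq> N" "card Q = 4"
    using exists_subset_between[OF assms(2) card_ge_4 assms(1) fin] by metis
  moreover have "finite Q" using \<open>Q \<subseteq> N\<close> fin by (rule finite_subset)
  ultimately show thesis using that by (auto simp: nsets_def)
qed

lemma in_nsets_mono: "e \<in> [W]\<^bsup>k\<^esup> \<Longrightarrow> W \<subseteq> Q \<Longrightarrow> e \<in> [Q]\<^bsup>k\<^esup>"
  by (auto simp: nsets_def)

definition repeats :: "'v set set" where
  "repeats = {W \<in> [N]\<^bsup>3\<^esup>. \<exists>e\<in>[W]\<^bsup>2\<^esup>. \<exists>f\<in>[W]\<^bsup>2\<^esup>. e \<noteq> f \<and> c e = c f \<and> c e \<noteq> i}"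

text \<open>In a four-set containing the triangle, both \<open>e\<close> and the third edge
  \<open>g\<close> would be redundant.\<close>

lemma repeats_third:
  assumes W: "W \<in> [N]\<^bsup>3\<^esup>" and e: "e \<in> [W]\<^bsup>2\<^esup>" "f \<in> [W]\<^bsup>2\<^esup>" "g \<in> [W]\<^bsup>2\<^esup>"
    and ne: "e \<noteq> f" "e \<noteq> g" "f \<noteq> g" and c: "c e = c f"
  shows "c g \<noteq> i" "c g \<noteq> c f"
proof -
  have "W \<subseteq> N" "card W \<le> 4" using W by (auto simp: nsets_def)
  then obtain Q where Q: "Q \<in> [N]\<^bsup>4\<^esup>" "W \<subseteq> Q" using extend_four by blast
  note eQ = in_nsets_mono[OF e(1) Q(2)] in_nsets_mono[OF e(2) Q(2)] in_nsets_mono[OF e(3) Q(2)]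
  have re: "c e = i \<or> (\<exists>h\<in>[Q]\<^bsup>2\<^esup> - {e, g}. c h = c e)"
    using eQ(2) ne c by (intro disjI2 bexI[of _ f]) auto
  show "c g \<noteq> i"
    using no_two_repeats[OF Q(1) eQ(1,3) ne(2) re] by blast
  show "c g \<noteq> c f"
  proof
    assume "c g = c f"
    then have "c g = i \<or> (\<exists>h\<in>[Q]\<^bsup>2\<^esup> - {e, g}. c h = c g)"
      using eQ(2) ne by (intro disjI2 bexI[of _ f]) auto
    then show False using no_two_repeats[OF Q(1) eQ(1,3) ne(2) re] by blast
  qed
qed

lemma repeats_color_ne:
  assumes "W \<in> repeats" "g \<in> [W]\<^bsup>2\<^esup>"
  shows "c g \<noteq> i"
proof -
  obtain e f where "W \<in> [N]\<^bsup>3\<^esup>" "e \<in> [W]\<^bsup>2\<^esup>" "f \<in> [W]\<^bsup>2\<^esup>" "e \<noteq> f" "c e = c f" "c e \<noteq> i"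
    using assms(1) unfolding repeats_def by blast
  then show ?thesis using repeats_third(1)[of W e f g] assms(2) by metis
qed

text \<open>Two triangles with a common edge span a four-set, and each brings a redundant edge that
  lies outside the other.\<close>

lemma repeats_edge_disjoint:
  assumes W: "W \<in> repeats" "W' \<in> repeats" "W \<noteq> W'"
  shows "card (W \<inter> W') \<le> 1"
proof (rule ccontr)
  assume big: "\<not> card (W \<inter> W') \<le> 1"
  have WN: "W \<in> [N]\<^bsup>3\<^esup>" "W' \<in> [N]\<^bsup>3\<^esup>" using W unfolding repeats_def by auto
  then have cW: "finite W" "finite W'" "card W = 3" "card W' = 3" "W \<subseteq> N" "W' \<subseteq> N"
    by (auto simp: nsets_def)
  have "\<not> W \<subseteq> W'" using card_subset_eq[OF cW(2)] cW W(3) by auto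
  then have "W \<inter> W' \<subset> W" by blast
  then have "card (W \<inter> W') < 3" using psubset_card_mono[OF cW(1)] cW(3) by metis
  then have I: "card (W \<inter> W') = 2" using big by simp
  then have "card (W \<union> W') = 4" using card_Un_Int[OF cW(1,2)] cW by simp
  then have Q: "W \<union> W' \<in> [N]\<^bsup>4\<^esup>" using cW by (auto simp: nsets_def)
  have ex: "\<exists>e f. e \<in> [U]\<^bsup>2\<^esup> \<and> f \<in> [U]\<^bsup>2\<^esup> \<and> e \<noteq> f \<and> c e = c f \<and> \<not> e \<subseteq> U'"
    if U: "U \<in> repeats" and UU': "card (U \<inter> U') = 2" for U U'
  proof -
    obtain e f where ef: "e \<in> [U]\<^bsup>2\<^esup>" "f \<in> [U]\<^bsup>2\<^esup>" "e \<noteq> f" "c e = c f"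
      using U unfolding repeats_def by blast
    \<comment> \<open>The shared edge is the only edge of \<open>U\<close> inside \<open>U'\<close>,
      so one of the two equally coloured edges leaves \<open>U'\<close>.\<close>
    have "g = U \<inter> U'" if "g \<in> [U]\<^bsup>2\<^esup>" "g \<subseteq> U'" for g
    proof (rule card_subset_eq)
      show "finite (U \<inter> U')" by (rule ccontr) (use UU' in simp)
    qed (use that UU' in \<open>auto simp: nsets_def\<close>)
    note eq = this
    show ?thesis
    proof (cases "e \<subseteq> U'")
      case True
      then have "\<not> f \<subseteq> U'" using eq[OF ef(1)] eq[OF ef(2)] ef(3) by auto
      then show ?thesis using ef(1-3) ef(4)[symmetric] by blast
    next
      case False
      then show ?thesis using ef by blast
    qed
  qed
  obtain e e' where e: "e \<in> [W]\<^bsup>2\<^esup>" "e' \<in> [W]\<^bsup>2\<^esup>" "e \<noteq> e'" "c e = c e'" "\<not> e \<subseteq> W'"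
    using ex[OF W(1) I] by (elim exE conjE) (rule that)
  have I': "card (W' \<inter> W) = 2" using I by (simp only: Int_commute)
  obtain f f' where f: "f \<in> [W']\<^bsup>2\<^esup>" "f' \<in> [W']\<^bsup>2\<^esup>" "f \<noteq> f'" "c f = c f'" "\<not> f \<subseteq> W"
    using ex[OF W(2) I'] by (elim exE conjE) (rule that)
  have "e \<subseteq> W" "e' \<subseteq> W" "f \<subseteq> W'" "f' \<subseteq> W'" using e(1,2) f(1,2) by (auto simp: nsets_def)
  then have ne: "e \<noteq> f" "e' \<noteq> f" "f' \<noteq> e" using e(5) f(5) by auto
  show False
  proof (rule no_two_repeats[OF Q _ _ ne(1)])
    show "e \<in> [W \<union> W']\<^bsup>2\<^esup>" "f \<in> [W \<union> W']\<^bsup>2\<^esup>"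
      by (rule in_nsets_mono[OF e(1)], simp) (rule in_nsets_mono[OF f(1)], simp)
    have e': "e' \<in> [W \<union> W']\<^bsup>2\<^esup> - {e, f}" and f': "f' \<in> [W \<union> W']\<^bsup>2\<^esup> - {e, f}"
      using in_nsets_mono[OF e(2), of "W \<union> W'"] in_nsets_mono[OF f(2), of "W \<union> W'"] e(3) f(3) ne
      by auto
    show "c e = i \<or> (\<exists>h\<in>[W \<union> W']\<^bsup>2\<^esup> - {e, f}. c h = c e)"
      by (intro disjI2 bexI[OF _ e']) (rule e(4)[symmetric])
    show "c f = i \<or> (\<exists>h\<in>[W \<union> W']\<^bsup>2\<^esup> - {e, f}. c h = c f)"
      by (intro disjI2 bexI[OF _ f']) (rule f(4)[symmetric])
  qed
qed

section \<open>Incidences of vertices and colours\<close>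

definition nbrs :: "'v \<Rightarrow> 'c \<Rightarrow> 'v set" where
  "nbrs v k = {a \<in> N - {v}. c {v, a} = k}"

lemma card_nbrs_le_2:
  assumes "v \<in> N"
  shows "card (nbrs v k) \<le> 2"
proof (rule ccontr)
  assume "\<not> card (nbrs v k) \<le> 2"
  then have "3 \<le> card (nbrs v k)" by linarith
  then obtain B where B: "B \<subseteq> nbrs v k" "card B = 3"
    by (rule obtain_subset_with_card_n)
  obtain a b d where abd: "B = {a, b, d}" "a \<noteq> b" "b \<noteq> d" "a \<noteq> d"
    using card_3_iff[THEN iffD1, OF B(2)] by blast
  have N: "a \<in> N" "b \<in> N" "d \<in> N" "v \<noteq> a" "v \<noteq> b" "v \<noteq> d"
    and c: "c {v, a} = k" "c {v, b} = k" "c {v, d} = k"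
    using B(1) unfolding nbrs_def abd(1) by auto
  have Q: "{v, a, b, d} \<in> [N]\<^bsup>4\<^esup>" using assms N abd(2-4) by (auto simp: nsets_def)
  have e: "{v, a} \<in> [{v, a, b, d}]\<^bsup>2\<^esup>" "{v, b} \<in> [{v, a, b, d}]\<^bsup>2\<^esup>"
    using N by (auto simp: nsets_def)
  have d: "{v, d} \<in> [{v, a, b, d}]\<^bsup>2\<^esup> - {{v, a}, {v, b}}"
    using N abd(2-4) by (simp add: doubleton_eq_iff)
  have ne: "{v, a} \<noteq> {v, b}" using abd(2) by (simp add: doubleton_eq_iff)
  show False
    by (rule no_two_repeats[OF Q e ne]; intro disjI2 bexI[OF _ d]; simp add: c)
qed

lemma nbrs_repeats:
  assumes "v \<in> N" "card (nbrs v k) = 2" "k \<noteq> i"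
  shows "insert v (nbrs v k) \<in> repeats"
proof -
  obtain a b where ab: "nbrs v k = {a, b}" "a \<noteq> b" using assms(2) by (metis card_2_iff)
  then have N: "a \<in> N" "b \<in> N" "v \<noteq> a" "v \<noteq> b" and c: "c {v, a} = k" "c {v, b} = k"
    unfolding nbrs_def by auto
  have "{v, a, b} \<in> [N]\<^bsup>3\<^esup>" "{v, a} \<in> [{v, a, b}]\<^bsup>2\<^esup>" "{v, b} \<in> [{v, a, b}]\<^bsup>2\<^esup>"
    using assms(1) N ab(2) by (auto simp: nsets_def)
  moreover have "{v, a} \<noteq> {v, b}" using ab(2) by (auto simp: doubleton_eq_iff)
  ultimately show ?thesis
    unfolding repeats_def ab(1) using c assms(3)
    by (intro CollectI conjI bexI[of _ "{v, a}"] bexI[of _ "{v, b}"]) simp_all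
qed

text \<open>A triangle with two different middles would be monochromatic, against
  \<open>repeats_third\<close>.\<close>

lemma nbrs_repeats_inj:
  assumes v: "v \<in> N" "card (nbrs v k) = 2" and w: "w \<in> N" "card (nbrs w l) = 2"
    and eq: "insert v (nbrs v k) = insert w (nbrs w l)"
  shows "v = w \<and> k = l"
proof -
  obtain a b where ab: "nbrs v k = {a, b}" "a \<noteq> b" using v(2) by (metis card_2_iff)
  then have N: "a \<in> N" "b \<in> N" "v \<noteq> a" "v \<noteq> b" and c: "c {v, a} = k" "c {v, b} = k"
    unfolding nbrs_def by auto
  have nw: "nbrs w l = {v, a, b} - {w}" using eq ab(1) unfolding nbrs_def by auto
  have "v = w"
  proof (rule ccontr)
    assume "v \<noteq> w"
    then have l: "c {w, z} = l" if "z \<in> {v, a, b}" "z \<noteq> w" for z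
      using nw that unfolding nbrs_def by blast
    have "w = a \<or> w = b" using eq ab(1) \<open>v \<noteq> w\<close> by auto
    then have "c {v, a} = c {a, b} \<and> c {v, b} = c {a, b}"
    proof
      assume "w = a"
      then have "c {a, v} = l" "c {a, b} = l" using l[of v] l[of b] \<open>v \<noteq> w\<close> ab(2) by simp_all
      then show ?thesis using c by (simp add: insert_commute[of a v])
    next
      assume "w = b"
      then have "c {b, v} = l" "c {b, a} = l" using l[of v] l[of a] \<open>v \<noteq> w\<close> ab(2) by simp_all
      then show ?thesis using c by (simp add: insert_commute[of b])
    qed
    moreover have "{v, a, b} \<in> [N]\<^bsup>3\<^esup>" "{v, a} \<in> [{v, a, b}]\<^bsup>2\<^esup>"
      "{v, b} \<in> [{v, a, b}]\<^bsup>2\<^esup>" "{a, b} \<in> [{v, a, b}]\<^bsup>2\<^esup>"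
      using v(1) N ab(2) by (auto simp: nsets_def)
    moreover have "{v, a} \<noteq> {v, b}" "{v, a} \<noteq> {a, b}" "{v, b} \<noteq> {a, b}"
      using N ab(2) by (auto simp: doubleton_eq_iff)
    ultimately show False using repeats_third(2)[of "{v, a, b}" "{v, a}" "{v, b}" "{a, b}"] by metis
  qed
  moreover have "a \<in> nbrs w l" using nw N ab(2) \<open>v = w\<close> by auto
  then have "c {w, a} = l" unfolding nbrs_def by simp
  ultimately show ?thesis using c by simp
qed

definition pairs :: "('v \<times> 'v) set" where
  "pairs = {(v, a). v \<in> N \<and> a \<in> N \<and> v \<noteq> a \<and> c {v, a} \<noteq> i}"

lemma finite_pairs: "finite pairs"
  by (rule finite_subset[of _ "N \<times> N"]) (auto simp: pairs_def fin)

lemma card_off_diagonal: "finite A \<Longrightarrow> card {(v, a). v \<in> A \<and> a \<in> A \<and> v \<noteq> a} = card A * (card A - 1)"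
proof -
  assume A: "finite A"
  have "{(v, a). v \<in> A \<and> a \<in> A \<and> v \<noteq> a} = (SIGMA v:A. A - {v})" by auto
  then show ?thesis using A by simp
qed

text \<open>Two edges of colour \<open>i\<close> in a four-set are both redundant, so
  \<open>N\<close> contains at most one, accounting for two ordered pairs.\<close>

lemma card_pairs_ge: "card N * (card N - 1) \<le> card pairs + 2"
proof -
  define I where "I = {(v, a). v \<in> N \<and> a \<in> N \<and> v \<noteq> a \<and> c {v, a} = i}"
  have uniq: "{v, a} = {w, b}" if "(v, a) \<in> I" "(w, b) \<in> I" for v a w b
  proof (rule ccontr)
    assume ne: "{v, a} \<noteq> {w, b}"
    have N: "v \<in> N" "a \<in> N" "w \<in> N" "b \<in> N" "v \<noteq> a" "w \<noteq> b" "c {v, a} = i" "c {w, b} = i"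
      using that unfolding I_def by auto
    have "{v, a, w, b} \<subseteq> N" using N by simp
    moreover have "card {v, a, w, b} \<le> 4" by (simp add: card_insert_if)
    ultimately obtain Q where Q: "Q \<in> [N]\<^bsup>4\<^esup>" "{v, a, w, b} \<subseteq> Q" using extend_four by blast
    then have "{v, a} \<in> [Q]\<^bsup>2\<^esup>" "{w, b} \<in> [Q]\<^bsup>2\<^esup>" using N by (auto simp: nsets_def)
    then show False using no_two_repeats[OF Q(1) _ _ ne] N by blast
  qed
  have "card I \<le> 2"
  proof (cases "I = {}")
    case False
    then obtain v a where va: "(v, a) \<in> I" by auto
    have "I \<subseteq> {(v, a), (a, v)}" using uniq[OF va] by (auto simp: doubleton_eq_iff)
    then have "card I \<le> card {(v, a), (a, v)}" by (intro card_mono) auto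
    also have "\<dots> \<le> 2" by (cases "v = a") simp_all
    finally show ?thesis .
  qed simp
  moreover have "{(v, a). v \<in> N \<and> a \<in> N \<and> v \<noteq> a} = pairs \<union> I"
    unfolding pairs_def I_def by auto
  then have "card N * (card N - 1) \<le> card pairs + card I"
    using card_off_diagonal[OF fin] card_Un_le[of pairs I] by simp
  ultimately show ?thesis by simp
qed

text \<open>Edge-disjoint triangles occupy disjoint sixes of ordered pairs.\<close>

lemma card_repeats_le: "6 * card repeats \<le> card pairs"
proof -
  define P where "P W = {(v, a). v \<in> W \<and> a \<in> W \<and> v \<noteq> a}" for W :: "'v set"
  have W: "finite W" "card W = 3" "W \<subseteq> N" if "W \<in> repeats" for W
    using that unfolding repeats_def nsets_def by auto
  have fin_rep: "finite repeats"
    by (rule finite_subset[of _ "Pow N"]) (auto simp: fin dest: W(3))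
  have "card (\<Union>W\<in>repeats. P W) = (\<Sum>W\<in>repeats. card (P W))"
  proof (rule card_UN_disjoint[OF fin_rep])
    show "\<forall>W\<in>repeats. finite (P W)"
      using W(1) by (auto simp: P_def intro: finite_subset[of _ "W \<times> W" for W])
    show "\<forall>W\<in>repeats. \<forall>W'\<in>repeats. W \<noteq> W' \<longrightarrow> P W \<inter> P W' = {}"
    proof (intro ballI impI, rule ccontr)
      fix W W' assume *: "W \<in> repeats" "W' \<in> repeats" "W \<noteq> W'" "P W \<inter> P W' \<noteq> {}"
      then obtain v a where "{v, a} \<subseteq> W \<inter> W'" "v \<noteq> a" unfolding P_def by auto
      then have "card {v, a} \<le> card (W \<inter> W')" using W(1)[OF *(1)] by (intro card_mono) auto
      then show False using repeats_edge_disjoint[OF *(1-3)] \<open>v \<noteq> a\<close> by simp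
    qed
  qed
  also have "\<dots> = (\<Sum>W\<in>repeats. 6)"
    unfolding P_def by (rule sum.cong[OF refl]) (simp add: W(1,2) card_off_diagonal[OF W(1)])
  finally have "6 * card repeats = card (\<Union>W\<in>repeats. P W)" by simp
  also have "\<dots> \<le> card pairs"
  proof (rule card_mono[OF finite_pairs], rule subsetI)
    fix z assume "z \<in> (\<Union>W\<in>repeats. P W)"
    then obtain W v a where z: "W \<in> repeats" "z = (v, a)" "v \<in> W" "a \<in> W" "v \<noteq> a"
      unfolding P_def by auto
    then have "c {v, a} \<noteq> i" by (intro repeats_color_ne[OF z(1)]) (auto simp: nsets_def)
    then show "z \<in> pairs" using z W(3) unfolding pairs_def by auto
  qed
  finally show ?thesis .
qed

text \<open>Each incidence \<open>(v, k)\<close> accounts for at most one pair, plus one more if it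
  lies in \<open>Z\<close>; and \<open>Z\<close> injects into the triangles, which number at most a
  sixth of the pairs. So \<open>5/6\<close> of the pairs are bounded by
  \<open>card N * card K\<close>.\<close>

lemma card_bound:
  assumes K: "finite K" "c ` [N]\<^bsup>2\<^esup> \<subseteq> insert i K" "i \<notin> K"
  shows "5 * (card N * (card N - 1)) \<le> 6 * (card N * card K) + 10"
proof -
  define Z where "Z = {(v, k). v \<in> N \<and> k \<in> K \<and> card (nbrs v k) = 2}"
  have Z: "Z \<subseteq> N \<times> K" "finite Z"
    using finite_subset[of Z "N \<times> K"] fin K(1) unfolding Z_def by auto
  have "pairs = (\<Union>(v, k)\<in>N \<times> K. {v} \<times> nbrs v k)"
  proof -
    have "c {v, a} \<in> K" if "(v, a) \<in> pairs" for v a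
    proof -
      have "{v, a} \<in> [N]\<^bsup>2\<^esup>" using that by (auto simp: pairs_def nsets_def)
      then have "c {v, a} \<in> insert i K" using K(2) by blast
      then show ?thesis using that unfolding pairs_def by simp
    qed
    then show ?thesis using K(3) unfolding pairs_def nbrs_def by auto
  qed
  then have "card pairs \<le> (\<Sum>(v, k)\<in>N \<times> K. card ({v} \<times> nbrs v k))"
    using card_UN_le[of "N \<times> K" "\<lambda>(v, k). {v} \<times> nbrs v k"] fin K(1)
    by (simp add: case_prod_unfold)
  also have "\<dots> = (\<Sum>y\<in>N \<times> K. card (nbrs (fst y) (snd y)))"
    by (simp add: case_prod_unfold card_cartesian_product)
  also have "\<dots> \<le> (\<Sum>y\<in>N \<times> K. 1 + (if y \<in> Z then 1 else 0))"
  proof (rule sum_mono)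
    fix y assume "y \<in> N \<times> K"
    then show "card (nbrs (fst y) (snd y)) \<le> 1 + (if y \<in> Z then 1 else 0)"
      using card_nbrs_le_2[of "fst y" "snd y"] unfolding Z_def by (auto simp: case_prod_unfold)
  qed
  also have "\<dots> = (\<Sum>y\<in>N \<times> K. 1) + (\<Sum>y\<in>N \<times> K. if y \<in> Z then 1 else 0)"
    by (rule sum.distrib)
  also have "(\<Sum>y\<in>N \<times> K. if y \<in> Z then 1 else 0) = card Z"
    using Z fin K(1) by (simp add: sum.If_cases Int_absorb1)
  also have "(\<Sum>y\<in>N \<times> K. 1) = card N * card K" by (simp add: card_cartesian_product)
  also have "card Z \<le> card repeats"
  proof (rule card_inj_on_le)
    show "inj_on (\<lambda>(v, k). insert v (nbrs v k)) Z"
      using nbrs_repeats_inj by (fastforce simp: Z_def intro: inj_onI)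
    show "(\<lambda>(v, k). insert v (nbrs v k)) ` Z \<subseteq> repeats"
      using nbrs_repeats K(3) unfolding Z_def by auto
    show "finite repeats"
      by (rule finite_subset[of _ "Pow N"]) (auto simp: fin repeats_def nsets_def)
  qed
  finally show ?thesis using card_repeats_le card_pairs_ge by linarith
qed

end

section \<open>From a colour neighbourhood to the number of colours\<close>

lemma pq_coloring_5_6_lower:
  assumes c: "pq_coloring n 5 6 c" and n: "400 \<le> n"
  shows "sqrt (5 / 6 * real n - 95 / 144) \<le> real (card (c ` [{..<n}]\<^bsup>2\<^esup>))"
proof -
  define C where "C = c ` [{..<n}]\<^bsup>2\<^esup>"
  define k where "k = card C"
  define N where "N i = {j \<in> {1..<n}. c {0, j} = i}" for i
  have finC: "finite C" unfolding C_def by (intro finite_imageI finite_imp_finite_nsets) simp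
  have edge: "c {0, j} \<in> C" if "j \<in> {1..<n}" for j
    unfolding C_def using that by (intro imageI) simp
  have finN: "finite (N i)" for i unfolding N_def by simp
  have "{1..<n} \<subseteq> (\<Union>i\<in>C. N i)" using edge unfolding N_def by auto
  then have "card {1..<n} \<le> card (\<Union>i\<in>C. N i)" by (rule card_mono[rotated]) (use finC finN in auto)
  also have "\<dots> \<le> (\<Sum>i\<in>C. card (N i))" by (rule card_UN_le[OF finC])
  finally have sum: "n - 1 \<le> (\<Sum>i\<in>C. card (N i))" by simp
  have "C \<noteq> {}" using edge[of 1] n by auto
  \<comment> \<open>Averaging over the colours at vertex \<open>0\<close>.\<close>
  have "\<exists>i\<in>C. n - 1 \<le> k * card (N i)"
  proof (rule ccontr)
    assume "\<not> (\<exists>i\<in>C. n - 1 \<le> k * card (N i))"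
    then have "(\<Sum>i\<in>C. k * card (N i)) < (\<Sum>i\<in>C. n - 1)"
      using \<open>C \<noteq> {}\<close> finC by (intro sum_strict_mono) auto
    also have "\<dots> = k * (n - 1)" by (simp add: k_def)
    also have "\<dots> \<le> k * (\<Sum>i\<in>C. card (N i))" using sum by simp
    finally show False by (simp add: sum_distrib_left)
  qed
  then obtain i where i: "i \<in> C" "n - 1 \<le> k * card (N i)" by blast
  define m where "m = card (N i)"
  have "real (n - 1) \<le> real (k * m)" using i(2) unfolding m_def by (simp only: of_nat_le_iff)
  then have nkm: "real n - 1 \<le> real k * real m" using n by (simp add: of_nat_diff)
  have "5 / 6 * real n - 95 / 144 \<le> (real k)\<^sup>2"
  \<comment> \<open>For \<open>m <= 19\<close> the estimate \<open>n - 1 <= 19 * k\<close> suffices,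
    as \<open>n >= 400\<close> exceeds \<open>19 * 19\<close>. For \<open>m >= 20\<close> the
    additive 10 of \<open>card_bound\<close> is smaller than \<open>m\<close>, so it disappears
    after division by \<open>m\<close>, and \<open>k >= 17\<close> follows.\<close>
  proof (cases "m \<le> 19")
    case True
    then have "real k * real m \<le> real k * 19" by (intro mult_left_mono) auto
    then have "(real n - 1)\<^sup>2 \<le> (19 * real k)\<^sup>2" using nkm n by (intro power_mono) auto
    moreover have "361 * real n \<le> (real n - 1)\<^sup>2"
    proof -
      have "400 * real n \<le> real n * real n" using n by (intro mult_right_mono) auto
      moreover have "(real n - 1)\<^sup>2 = real n * real n - 2 * real n + 1"
        by (simp add: power2_eq_square algebra_simps)
      moreover have "400 \<le> real n" using n by simp
      ultimately show ?thesis by linarith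
    qed
    moreover have "(19 * real k)\<^sup>2 = 361 * (real k)\<^sup>2" by (simp add: power_mult_distrib)
    ultimately have "real n \<le> (real k)\<^sup>2" by linarith
    then show ?thesis by linarith
  next
    case False
    interpret four_sets_five_colors "N i" c i
    proof
      show "finite (N i)" by (rule finN)
      show "4 \<le> card (N i)" using False m_def by simp
      fix Q assume "Q \<in> [N i]\<^bsup>4\<^esup>"
      then have Q: "Q \<subseteq> N i" "finite Q" "card Q = 4" by (auto simp: nsets_def)
      have "0 \<notin> Q" using Q(1) N_def by auto
      then have "insert 0 Q \<in> [{..<n}]\<^bsup>5\<^esup>" using Q n unfolding nsets_def N_def by auto
      then have "6 \<le> card (c ` [insert 0 Q]\<^bsup>2\<^esup>)" using c unfolding pq_coloring_def by blast
      also have "\<dots> \<le> card (insert i (c ` [Q]\<^bsup>2\<^esup> - {i}))"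
      proof (rule card_mono)
        show "finite (insert i (c ` [Q]\<^bsup>2\<^esup> - {i}))"
          using finite_imp_finite_nsets[OF Q(2)] by simp
        show "c ` [insert 0 Q]\<^bsup>2\<^esup> \<subseteq> insert i (c ` [Q]\<^bsup>2\<^esup> - {i})"
        proof
          fix z assume "z \<in> c ` [insert 0 Q]\<^bsup>2\<^esup>"
          then obtain e where e: "e \<in> [insert 0 Q]\<^bsup>2\<^esup>" "z = c e" by blast
          then obtain a b where ab: "e = {a, b}" "a \<in> insert 0 Q" "b \<in> insert 0 Q" "a \<noteq> b"
            by (elim nsets2_E)
          show "z \<in> insert i (c ` [Q]\<^bsup>2\<^esup> - {i})"
          proof (cases "a = 0 \<or> b = 0")
            case True
            then have "c e = i"
              using ab Q(1) unfolding N_def by (auto simp: insert_commute)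
            then show ?thesis using e(2) by simp
          next
            case False
            then have "e \<in> [Q]\<^bsup>2\<^esup>" using ab by simp
            then show ?thesis using e(2) by blast
          qed
        qed
      qed
      also have "\<dots> = Suc (card (c ` [Q]\<^bsup>2\<^esup> - {i}))"
        using finite_imp_finite_nsets[OF Q(2)] by (intro card_insert_disjoint) auto
      finally show "5 \<le> card (c ` [Q]\<^bsup>2\<^esup> - {i})" by simp
    qed
    have "c ` [N i]\<^bsup>2\<^esup> \<subseteq> C"
      unfolding C_def by (intro image_mono nsets_mono) (auto simp: N_def)
    then have "5 * (m * (m - 1)) \<le> 6 * (m * card (C - {i})) + 10"
      unfolding m_def by (intro card_bound) (use finC in auto)
    moreover have "card (C - {i}) = k - 1" using i(1) finC k_def by simp
    ultimately have le: "m * (5 * (m - 1)) \<le> m * (6 * (k - 1)) + 10" by (simp add: algebra_simps)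
    have "5 * (m - 1) \<le> 6 * (k - 1)"
    proof (rule ccontr)
      assume "\<not> 5 * (m - 1) \<le> 6 * (k - 1)"
      then have "m * (6 * (k - 1) + 1) \<le> m * (5 * (m - 1))" by (intro mult_le_mono) auto
      then show False using le False by (simp add: algebra_simps)
    qed
    then have "5 * m + 1 \<le> 6 * k" "17 \<le> k" using False by linarith+
    then have km: "5 * real m \<le> 6 * real k - 1" "17 \<le> real k" by linarith+
    have "5 * (real n - 1) \<le> real k * (5 * real m)" using nkm by simp
    also have "\<dots> \<le> real k * (6 * real k - 1)" using km by (intro mult_left_mono) auto
    finally have "5 * (real n - 1) \<le> 6 * (real k)\<^sup>2 - real k"
      by (simp add: power2_eq_square algebra_simps)
    moreover have "5 / 6 * u - 95 / 144 \<le> z" if "5 * (u - 1) \<le> 6 * z - w" "17 \<le> w" for u z w :: real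
    proof -
      \<comment> \<open>The linear term \<open>w >= 17\<close> outweighs the 5 lost on the left, so
        the constant \<open>95 / 144\<close> leaves room.\<close>
      have "5 * u + 12 \<le> 6 * z" using that by argo
      then show ?thesis by (simp add: field_simps)
    qed
    ultimately show ?thesis using km(2) by blast
  qed
  then have "sqrt (5 / 6 * real n - 95 / 144) \<le> sqrt ((real k)\<^sup>2)" by (rule real_sqrt_le_mono)
  then show ?thesis unfolding k_def C_def by simp
qed

section \<open>Asymptotics\<close>

lemma color_count_bound:
  fixes n l t :: nat
  assumes n: "2 ^ 16 \<le> n" and l: "4 ^ l \<le> 16 * n" "3 \<le> l" and p: "p \<le> 2 * (2 ^ l * l) + (1::nat)"
    and t: "real t \<le> sqrt (2 * real l) + 1"
  shows "real (p * (t * t + 1) * 2 ^ t * 2 ^ t * (t + 1) ^ t)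
    \<le> sqrt (real n) * 2 powr (4 * sqrt (log 2 (real n)) * log 2 (log 2 (real n)))"
proof -
  \<comment> \<open>The bound \<open>2 ^ 16\<close> on \<open>n\<close> makes \<open>L >= 16\<close>
    and \<open>S, Q >= 4\<close>, enough to absorb all lower-order factors.\<close>
  define L S Q where "L = log 2 (real n)" and "S = sqrt L" and "Q = log 2 L"
  have n0: "0 < real n" using n by simp
  have "log 2 (2 ^ 16) \<le> L"
    unfolding L_def using n by (subst log_le_cancel_iff) (auto simp flip: of_nat_le_iff)
  moreover have "log 2 (2 ^ 16 :: real) = 16" using log_pow_cancel[of 2 16] by simp
  ultimately have L: "16 \<le> L" by linarith
  have S: "S * S = L" using L unfolding S_def by simp
  have S4: "4 \<le> S" unfolding S_def by (rule real_le_rsqrt) (use L in simp)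
  have "log 2 (2 ^ 4) \<le> Q" unfolding Q_def using L by (subst log_le_cancel_iff) auto
  moreover have "log 2 (2 ^ 4 :: real) = 4" using log_pow_cancel[of 2 4] by simp
  ultimately have Q4: "4 \<le> Q" by linarith
  have LQ: "2 powr Q = L" unfolding Q_def using L by simp
  have "real (4 ^ l) \<le> real (16 * n)" using l(1) by (simp only: of_nat_le_iff)
  then have l4: "4 ^ l \<le> 16 * real n" by simp
  then have "log 2 (4 ^ l) \<le> log 2 (16 * real n)"
    using n0 by (subst log_le_cancel_iff) auto
  moreover have "log 2 (4 ^ l) = 2 * real l"
    using log_nat_power[of 4 2 l] log_nat_power[of 2 2 2] by simp
  moreover have "log 2 (16 * real n) = 4 + L"
    using log_mult[of 2 16 "real n"] log_nat_power[of 2 2 4] n0 unfolding L_def by simp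
  ultimately have l2: "2 * real l \<le> L + 4" by simp
  have "sqrt (2 * real l) \<le> S + 1"
  proof (rule real_le_lsqrt)
    show "2 * real l \<le> (S + 1)\<^sup>2" using l2 S S4 by (simp add: power2_eq_square algebra_simps)
  qed (use S4 in auto)
  then have tS: "real t + 1 \<le> 2 * S" using t S4 by linarith
  have tL: "real t + 1 \<le> L" using tS mult_right_mono[OF S4, of S] S S4 by linarith
  have "2 ^ l \<le> 4 * sqrt (real n)"
  proof (rule power2_le_imp_le)
    have "(2 ^ l)\<^sup>2 = (4 ^ l :: real)" by (simp add: power2_eq_square flip: power_mult_distrib)
    also note l4
    finally show "(2 ^ l)\<^sup>2 \<le> (4 * sqrt (real n))\<^sup>2" by (simp add: power_mult_distrib)
  qed simp
  then have pl: "2 ^ l * real l \<le> 4 * sqrt (real n) * (L / 2 + 2)"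
    using l2 by (intro mult_mono) auto
  have "1 \<le> 2 ^ l * real l" using mult_mono[of 1 "2 ^ l" 1 "real l"] l(2) by simp
  moreover have "real p \<le> real (2 * (2 ^ l * l) + 1)" using p by (simp only: of_nat_le_iff)
  ultimately have "real p \<le> 3 * (2 ^ l * real l)" by simp
  also have "\<dots> \<le> 3 * (4 * sqrt (real n) * (L / 2 + 2))" by (intro mult_left_mono pl) simp
  also have "\<dots> = sqrt (real n) * (6 * L + 24)" by (simp add: algebra_simps)
  also have "\<dots> \<le> sqrt (real n) * (L * L)"
  proof (rule mult_left_mono)
    have "16 * L \<le> L * L" using L by (intro mult_right_mono) auto
    then show "6 * L + 24 \<le> L * L" using L by linarith
  qed simp
  finally have b1: "real p \<le> sqrt (real n) * (L * L)" .
  have "(real t + 1) * (real t + 1) \<le> L * L" using tL by (intro mult_mono) auto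
  then have b2: "real (t * t + 1) \<le> L * L" by (simp add: algebra_simps)
  have b3: "2 ^ t \<le> 2 powr (2 * S)"
    using tS by (subst powr_realpow[symmetric]) auto
  have "(real t + 1) ^ t \<le> L ^ t" using tL by (intro power_mono) auto
  also have "\<dots> = L powr real t" using L by (simp add: powr_realpow)
  also have "\<dots> \<le> L powr (2 * S)" using L tS by (intro powr_mono) auto
  also have "\<dots> = 2 powr (Q * (2 * S))" by (simp only: LQ[symmetric] powr_powr)
  finally have b4: "(real t + 1) ^ t \<le> 2 powr (Q * (2 * S))" .
  have LL: "L * L = 2 powr (2 * Q)" by (simp add: LQ[symmetric] flip: powr_add)
  have "real (p * (t * t + 1) * 2 ^ t * 2 ^ t * (t + 1) ^ t)
    = real p * real (t * t + 1) * 2 ^ t * 2 ^ t * (real t + 1) ^ t"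
    by (simp only: of_nat_mult of_nat_power of_nat_add of_nat_1 of_nat_numeral)
  also have "\<dots> \<le> sqrt (real n) * (L * L) * (L * L) * 2 powr (2 * S) * 2 powr (2 * S)
      * 2 powr (Q * (2 * S))"
    using b1 b2 b3 b4 L by (intro mult_mono) auto
  also have "\<dots> = sqrt (real n) * 2 powr (2 * Q + 2 * Q + 2 * S + 2 * S + Q * (2 * S))"
    unfolding LL by (simp only: powr_add mult.assoc)
  also have "\<dots> \<le> sqrt (real n) * 2 powr (4 * S * Q)"
  proof -
    \<comment> \<open>The exponent is \<open>4 * Q + 4 * S + 2 * S * Q\<close>; each of the first
      two terms is at most \<open>S * Q\<close>, whence the constant 4.\<close>
    have "4 * Q \<le> S * Q" "S * 4 \<le> S * Q" using S4 Q4 by (auto intro: mult_right_mono mult_left_mono)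
    then have "2 * Q + 2 * Q + 2 * S + 2 * S + Q * (2 * S) \<le> 4 * S * Q"
      by (simp add: algebra_simps)
    then show ?thesis by (intro mult_left_mono powr_mono) auto
  qed
  finally show ?thesis unfolding L_def S_def Q_def .
qed

lemma ex_coloring_5_6:
  assumes n: "2 ^ 16 \<le> n"
  shows "\<exists>c. pq_coloring n 5 6 c \<and> real (card (c ` [{..<n}]\<^bsup>2\<^esup>))
    \<le> sqrt (real n) * 2 powr (4 * sqrt (log 2 (real n)) * log 2 (log 2 (real n)))"
proof -
  have "n < 2 ^ n" by (rule less_exp)
  also have "\<dots> \<le> 4 ^ n" by (rule power_mono) auto
  also have "4 * 4 ^ n = (4 ^ Suc n :: nat)" by simp
  finally have ex: "\<exists>l. 4 * n \<le> 4 ^ l" by (intro exI[of _ "Suc n"]) simp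
  \<comment> \<open>The least \<open>l\<close> with \<open>2 ^ l >= 2 * sqrt n\<close>: a prime
    above \<open>2 ^ l\<close> leaves a grid large enough for \<open>n\<close> vertices, and
    minimality keeps \<open>4 ^ l\<close> below \<open>16 * n\<close>.\<close>
  define l where "l = (LEAST l. 4 * n \<le> 4 ^ l)"
  have l: "4 * n \<le> 4 ^ l" unfolding l_def by (rule LeastI_ex[OF ex])
  have l3: "3 \<le> l"
  proof (rule ccontr)
    assume "\<not> 3 \<le> l"
    then have "(4::nat) ^ l \<le> 4 ^ 3" by (intro power_increasing) auto
    then show False using l n by simp
  qed
  then obtain l' where l': "l = Suc l'" by (cases l) auto
  have "\<not> 4 * n \<le> 4 ^ l'" using not_less_Least[of l' "\<lambda>l. 4 * n \<le> 4 ^ l"] l' l_def by simp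
  then have l_le: "4 ^ l \<le> 16 * n" unfolding l' by simp
  obtain p where p: "prime p" "2 ^ l < p" "p \<le> 2 * (2 ^ l * l) + (1::nat)"
    by (rule ex_prime_between[OF l3])
  \<comment> \<open>\<open>t * t >= 2 * l\<close> makes \<open>2 ^ (t * t)\<close> at least
    \<open>4 ^ l > p\<close>, so the coordinates fit into \<open>t\<close> digits of
    \<open>t\<close> bits.\<close>
  define t where "t = nat \<lceil>sqrt (2 * real l)\<rceil>"
  have t: "sqrt (2 * real l) \<le> real t" "real t \<le> sqrt (2 * real l) + 1"
    unfolding t_def using ceiling_correct[of "sqrt (2 * real l)"] by (simp_all add: real_nat_ceiling_ge)
  have "2 * real l \<le> real t * real t"
    using mult_mono[OF t(1) t(1)] by simp
  then have tl: "2 * l \<le> t * t" by (metis of_nat_le_iff of_nat_mult of_nat_numeral)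
  have "p \<le> 4 ^ l" using p(3) double_mult_plus_1_less_power4[OF l3] by linarith
  also have "(4::nat) ^ l = 2 ^ (2 * l)" by (simp add: power_mult)
  also have "\<dots> \<le> 2 ^ (t * t)" using tl by (intro power_increasing) auto
  finally have "p \<le> 2 ^ (t * t)" .
  moreover have "4 * n \<le> p * p"
  proof -
    have "(4::nat) ^ l = 2 ^ l * 2 ^ l" by (simp flip: power_mult_distrib)
    also have "\<dots> \<le> p * p" using p(2) by (intro mult_le_mono) auto
    finally show ?thesis using l by simp
  qed
  moreover have "2 < p"
    using p(2) power_increasing[of 1 l "2::nat"] l3 by simp
  ultimately obtain c where c: "pq_coloring n 5 6 c"
    "card (c ` [{..<n}]\<^bsup>2\<^esup>) \<le> p * (t * t + 1) * 2 ^ t * 2 ^ t * (t + 1) ^ t"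
    using ex_coloring[OF p(1)] by blast
  have "real (card (c ` [{..<n}]\<^bsup>2\<^esup>)) \<le> real (p * (t * t + 1) * 2 ^ t * 2 ^ t * (t + 1) ^ t)"
    using c(2) by (simp only: of_nat_le_iff)
  also note color_count_bound[OF n l_le l3 p(3) t(2)]
  finally show ?thesis using c(1) by blast
qed

theorem theorem1:
  shows "\<exists>C::real. C > 0 \<and> (\<exists>N::nat. \<forall>n\<ge>N.
           sqrt (5 / 6 * real n - 95 / 144) \<le> real (min_colors n 5 6) \<and>
           real (min_colors n 5 6)
             \<le> sqrt (real n) * 2 powr (C * sqrt (log 2 (real n)) * log 2 (log 2 (real n))))"
proof (intro exI[of _ "4::real"] conjI exI[of _ "2 ^ 16 :: nat"] allI impI)
  fix n :: nat assume n: "2 ^ 16 \<le> n"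
  let ?P = "\<lambda>k. \<exists>c. pq_coloring n 5 6 c \<and> card (c ` [{..<n}]\<^bsup>2\<^esup>) = k"
  obtain c where c: "pq_coloring n 5 6 c" "real (card (c ` [{..<n}]\<^bsup>2\<^esup>))
      \<le> sqrt (real n) * 2 powr (4 * sqrt (log 2 (real n)) * log 2 (log 2 (real n)))"
    using ex_coloring_5_6[OF n] by blast
  have P: "?P (card (c ` [{..<n}]\<^bsup>2\<^esup>))" using c(1) by blast
  \<comment> \<open>The minimum is attained, so the lower bound applies to an optimal colouring
    \<open>d\<close>.\<close>
  have "?P (min_colors n 5 6)" unfolding min_colors_def by (rule LeastI[of ?P, OF P])
  then obtain d where d: "pq_coloring n 5 6 d" "card (d ` [{..<n}]\<^bsup>2\<^esup>) = min_colors n 5 6"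
    by blast
  show "sqrt (5 / 6 * real n - 95 / 144) \<le> real (min_colors n 5 6)"
    using pq_coloring_5_6_lower[OF d(1)] d(2) n by simp
  have "min_colors n 5 6 \<le> card (c ` [{..<n}]\<^bsup>2\<^esup>)"
    unfolding min_colors_def by (rule Least_le[of ?P, OF P])
  then show "real (min_colors n 5 6)
      \<le> sqrt (real n) * 2 powr (4 * sqrt (log 2 (real n)) * log 2 (log 2 (real n)))"
    using c(2) by linarith
qed simp

end
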